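(* Let $\varepsilon>0$ and $K\in\mathbb N$. There exists $\kappa=\kappa(K,\varepsilon)>0$ such that the following holds. Suppose $f\in\mathcal D_\varepsilon$ is an analytic diffeomorphism of the circle $\mathbb T$ with rotation number $\alpha=\rho(f)\in\mathcal{BT}_K$, and $f$ is $\kappa$-close to $R_\alpha$ in $\mathcal D_\varepsilon$. Then $f$ is conformally conjugate to $R_\alpha$ in $\Pi_{\varepsilon/2}$.
   Context: $\mathbb T=\mathbb R/\mathbb Z\subset\mathbb C/\mathbb Z$, and for $\alpha\in\mathbb R$, $R_\alpha(z)=z+\alpha \bmod \mathbb Z$ is the rotation (acting on $\mathbb T$ and on $\mathbb C/\mathbb Z$). For $\varepsilon>0$, $\Pi_\varepsilon=\{|\operatorname{Im} z|<\varepsilon\}/\mathbb Z\subset\mathbb C/\mathbb Z$. $\mathcal D_\varepsilon$ is the affine Banach space of bounded analytic maps $\Pi_\varepsilon\to\mathbb C/\mathbb Z$ which extend continuously to the boundary, with the sup-norm; "$\kappa$-close" refers to the corresponding sup-distance. That $f\in\mathcal D_\varepsilon$ is an analytic diffeomorphism of the circle means that $f(\mathbb T)=\mathbb T$ and $f|_{\mathbb T}$ is a diffeomorphism; $\rho(f)$ is the rotation number of $f|_{\mathbb T}$, taken in $[0,1)$. For $K\in\mathbb N$, $\mathcal{BT}_K$ is the set of all irrational $\alpha\in(0,1)$ whose continued fraction expansion $\alpha=\cfrac{1}{a_0+\cfrac{1}{a_1+\cdots}}$, with positive integers $a_i$, satisfies $\sup_i a_i\le K$. "$f$ is conformally conjugate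 to $R_\alpha$ in $\Pi_{\varepsilon/2}$" means that there is an injective holomorphic map $\xi:\Pi_{\varepsilon/2}\to\Pi_\varepsilon$ with $f\circ\xi=\xi\circ R_\alpha$ on $\Pi_{\varepsilon/2}$. *)

theory Defs
  imports "HOL-Complex_Analysis.Complex_Analysis"
begin

quotient_type cyl = complex / "\<lambda>z w::complex. z - w \<in> \<int>"
proof (rule equivpI)
  show "reflp (\<lambda>z w::complex. z - w \<in> \<int>)" by (simp add: reflp_def)
  show "symp (\<lambda>z w::complex. z - w \<in> \<int>)"
  proof (rule sympI)
    fix x y :: complex assume "x - y \<in> \<int>"
    from Ints_minus[OF this] show "y - x \<in> \<int>" by simp
  qed
  show "transp (\<lambda>z w::complex. z - w \<in> \<int>)"
  proof (rule transpI)
    fix x y z :: complex assume "x - y \<in> \<int>" "y - z \<in> \<int>"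
    from Ints_add[OF this] show "x - z \<in> \<int>" by simp
  qed
qed

lift_definition proj :: "complex \<Rightarrow> cyl" is "\<lambda>z. z" .

lemma proj_eq_iff: "proj z = proj w \<longleftrightarrow> z - w \<in> \<int>"
  by transfer simp

lemma proj_cases: obtains z where "p = proj z"
  using cyl.abs_induct[of "\<lambda>p. \<exists>z. p = proj z" p] by (auto simp: proj_def)

lift_definition cIm :: "cyl \<Rightarrow> real" is Im
  by (auto simp: complex_is_Int_iff)

lift_definition rot :: "real \<Rightarrow> cyl \<Rightarrow> cyl" is "\<lambda>\<alpha> z. z + of_real \<alpha>"
  by simp

lemma cIm_proj: "cIm (proj z) = Im z"
  by transfer simp

lemma rot_proj: "rot \<alpha> (proj z) = proj (z + of_real \<alpha>)"
  by transfer simp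

lemma infdist_Ints_shift:
  fixes u :: complex
  assumes "n \<in> \<int>"
  shows "infdist (u + n) \<int> \<le> infdist u \<int>"
proof -
  obtain m where m: "m \<in> \<int>" "infdist u \<int> = dist u m"
    using infdist_attains_inf[of "\<int> :: complex set" u] closed_Ints Ints_0 by blast
  have "infdist (u + n) \<int> \<le> dist (u + n) (m + n)"
    using assms m by (intro infdist_le Ints_add)
  then show ?thesis using m by simp
qed

lemma infdist_Ints_cong:
  fixes u v :: complex
  assumes "u - v \<in> \<int>"
  shows "infdist u \<int> = infdist v \<int>"
  using infdist_Ints_shift[of "u - v" v] infdist_Ints_shift[of "- (u - v)" u] assms
    Ints_minus[OF assms]
  by simp

lemma infdist_Ints_add:
  fixes u v :: complex
  shows "infdist (u + v) \<int> \<le> infdist u \<int> + infdist v \<int>"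
proof -
  obtain m where m: "m \<in> \<int>" "infdist u \<int> = dist u m"
    using infdist_attains_inf[of "\<int> :: complex set" u] closed_Ints Ints_0 by blast
  obtain n where n: "n \<in> \<int>" "infdist v \<int> = dist v n"
    using infdist_attains_inf[of "\<int> :: complex set" v] closed_Ints Ints_0 by blast
  have "infdist (u + v) \<int> \<le> dist (u + v) (m + n)"
    using m n by (intro infdist_le Ints_add)
  also have "\<dots> \<le> dist u m + dist v n"
    by (rule dist_triangle_add)
  finally show ?thesis using m n by simp
qed

lemma infdist_Ints_minus:
  fixes u :: complex
  shows "infdist (- u) \<int> \<le> infdist u \<int>"
proof -
  obtain m where m: "m \<in> \<int>" "infdist u \<int> = dist u m"
    using infdist_attains_inf[of "\<int> :: complex set" u] closed_Ints Ints_0 by blast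
  have "infdist (- u) \<int> \<le> dist (- u) (- m)"
    using m by (intro infdist_le Ints_minus)
  then show ?thesis using m by (simp add: dist_minus)
qed

instantiation cyl :: metric_space
begin

text \<open>The flat quotient metric: the distance of two classes is the minimal distance of
  representatives.\<close>

lift_definition dist_cyl :: "cyl \<Rightarrow> cyl \<Rightarrow> real" is "\<lambda>z w. infdist (z - w) \<int>"
proof (rule infdist_Ints_cong)
  fix a b c d :: complex assume "a - b \<in> \<int>" "c - d \<in> \<int>"
  then have "(a - b) - (c - d) \<in> \<int>" by (rule Ints_diff)
  then show "a - c - (b - d) \<in> \<int>" by (simp add: algebra_simps)
qed

definition uniformity_cyl :: "(cyl \<times> cyl) filter" where
  "uniformity_cyl = (INF e\<in>{0 <..}. principal {(p, q). dist p q < e})"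

definition open_cyl :: "cyl set \<Rightarrow> bool" where
  "open_cyl U \<longleftrightarrow> (\<forall>p\<in>U. \<forall>\<^sub>F (p', q) in uniformity. p' = p \<longrightarrow> q \<in> U)"

instance
proof
  show "(uniformity :: (cyl \<times> cyl) filter) = (INF e\<in>{0 <..}. principal {(p, q). dist p q < e})"
    by (rule uniformity_cyl_def)
  show "open U \<longleftrightarrow> (\<forall>p\<in>U. \<forall>\<^sub>F (p', q) in uniformity. p' = p \<longrightarrow> q \<in> U)" for U :: "cyl set"
    by (rule open_cyl_def)
  show "dist p q = 0 \<longleftrightarrow> p = q" for p q :: cyl
  proof transfer
    fix z w :: complex
    show "infdist (z - w) \<int> = 0 \<longleftrightarrow> z - w \<in> \<int>"
      using in_closed_iff_infdist_zero[of "\<int> :: complex set" "z - w"] closed_Ints Ints_0 by blast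
  qed
  show "dist p q \<le> dist p r + dist q r" for p q r :: cyl
  proof transfer
    fix z w v :: complex
    show "infdist (z - w) \<int> \<le> infdist (z - v) \<int> + infdist (w - v) \<int>"
      using infdist_Ints_add[of "z - v" "v - w"] infdist_Ints_minus[of "w - v"] by simp
  qed
qed

end

lemma dist_proj: "dist (proj z) (proj w) = infdist (z - w) \<int>"
  by transfer simp

lemma dist_proj_le: "dist (proj z) (proj w) \<le> dist z w"
  unfolding dist_proj using infdist_le[of 0 "\<int>" "z - w"] by (simp add: dist_norm)

lemma dist_proj_attained:
  obtains w' where "proj w' = proj w" "dist (proj z) (proj w) = dist z w'"
proof -
  obtain m where m: "m \<in> \<int>" "infdist (z - w) \<int> = dist (z - w) m"
    using infdist_attains_inf[of "\<int> :: complex set" "z - w"] closed_Ints Ints_0 by blast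
  show thesis
    using m by (intro that[of "w + m"]) (simp_all add: proj_eq_iff dist_proj dist_norm algebra_simps)
qed

text \<open>The topology induced by the metric is the quotient topology.\<close>

lemma open_cyl_iff_quotient: "open U \<longleftrightarrow> open (proj -` U)" for U :: "cyl set"
proof
  assume U: "open U"
  show "open (proj -` U)"
    unfolding open_dist
  proof
    fix z assume "z \<in> proj -` U"
    then obtain e where e: "e > 0" "\<And>q. dist q (proj z) < e \<Longrightarrow> q \<in> U"
      using U unfolding open_dist by auto
    have "w \<in> proj -` U" if "dist w z < e" for w
      using e(2)[OF le_less_trans[OF dist_proj_le that]] by simp
    then show "\<exists>e>0. \<forall>w. dist w z < e \<longrightarrow> w \<in> proj -` U" using e(1) by blast
  qed
next
  assume U: "open (proj -` U)"
  show "open U"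
    unfolding open_dist
  proof
    fix p assume "p \<in> U"
    obtain z where z: "p = proj z" by (rule proj_cases)
    then obtain e where e: "e > 0" "\<And>w. dist w z < e \<Longrightarrow> proj w \<in> U"
      using U \<open>p \<in> U\<close> unfolding open_dist by auto
    have "q \<in> U" if q: "dist q p < e" for q
    proof -
      obtain w where w: "q = proj w" by (rule proj_cases)
      obtain w' where w': "proj w' = proj w" "dist (proj z) (proj w) = dist z w'"
        by (rule dist_proj_attained)
      have "dist w' z < e" using q w'(2) by (simp add: w z dist_commute)
      then show ?thesis using e(2)[of w'] w'(1) w by simp
    qed
    then show "\<exists>e>0. \<forall>q. dist q p < e \<longrightarrow> q \<in> U" using e by blast
  qed
qed

definition circle :: "cyl set" where
  "circle = {p. cIm p = 0}"

definition strip :: "real \<Rightarrow> cyl set" where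
  "strip \<epsilon> = {p. \<bar>cIm p\<bar> < \<epsilon>}"

text \<open>Holomorphy for the complex structure on \<open>\<complex>/\<int>\<close> whose charts are the local inverses of
  \<^term>\<open>proj\<close>; meant for open \<open>S\<close>.\<close>

definition cyl_holomorphic_on :: "(cyl \<Rightarrow> cyl) \<Rightarrow> cyl set \<Rightarrow> bool" where
  "cyl_holomorphic_on f S \<longleftrightarrow>
     (\<forall>z. proj z \<in> S \<longrightarrow>
       (\<exists>e>0. \<exists>g. g holomorphic_on ball z e \<and> (\<forall>w\<in>ball z e. f (proj w) = proj (g w))))"

text \<open>Only the values on \<^term>\<open>strip \<epsilon>\<close> are constrained. No degree is prescribed: a map at
  uniform distance less than \<open>1/2\<close> from a rotation has degree one automatically.\<close>

definition D_space :: "real \<Rightarrow> (cyl \<Rightarrow> cyl) set" where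
  "D_space \<epsilon> = {f. cyl_holomorphic_on f (strip \<epsilon>) \<and> bounded (f ` strip \<epsilon>) \<and>
     (\<exists>g. continuous_on (closure (strip \<epsilon>)) g \<and> (\<forall>p\<in>strip \<epsilon>. g p = f p))}"

text \<open>The supremum is over a bounded set for \<open>f, g\<close> in \<^term>\<open>D_space \<epsilon>\<close>. Whenever it is less than
  \<open>1/2\<close>, it is the sup-norm of the small complex-valued lift of \<open>f - g\<close>.\<close>

definition sup_dist :: "real \<Rightarrow> (cyl \<Rightarrow> cyl) \<Rightarrow> (cyl \<Rightarrow> cyl) \<Rightarrow> real" where
  "sup_dist \<epsilon> f g = (SUP p\<in>strip \<epsilon>. dist (f p) (g p))"

definition circle_smooth :: "(cyl \<Rightarrow> cyl) \<Rightarrow> bool" where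
  "circle_smooth f \<longleftrightarrow>
     (\<forall>x::real. \<exists>e>0. \<exists>h::real \<Rightarrow> real.
        (\<forall>y\<in>ball x e. f (proj (of_real y)) = proj (of_real (h y))) \<and>
        (\<forall>n. \<forall>y\<in>ball x e. (deriv ^^ n) h field_differentiable at y))"

definition circle_diffeo :: "(cyl \<Rightarrow> cyl) \<Rightarrow> bool" where
  "circle_diffeo f \<longleftrightarrow>
     bij_betw f circle circle \<and> circle_smooth f \<and> circle_smooth (inv_into circle f)"

definition circle_lift :: "(cyl \<Rightarrow> cyl) \<Rightarrow> (real \<Rightarrow> real) \<Rightarrow> bool" where
  "circle_lift f F \<longleftrightarrow>
     continuous_on UNIV F \<and> (\<forall>x. f (proj (of_real x)) = proj (of_real (F x)))"

text \<open>The limit exists, and modulo \<open>\<int>\<close> depends neither on the lift nor on the base point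
  \<open>0\<close>, for every circle diffeomorphism \<open>f\<close>.\<close>

definition rotation_number :: "(cyl \<Rightarrow> cyl) \<Rightarrow> real" where
  "rotation_number f =
     (let F = (SOME F. circle_lift f F) in frac (lim (\<lambda>n. (F ^^ n) 0 / real n)))"

text \<open>\<open>cf a n = 1 / (a 0 + 1 / (a 1 + \<dots> + 1 / a (n - 1)))\<close>\<close>

fun cf :: "(nat \<Rightarrow> nat) \<Rightarrow> nat \<Rightarrow> real" where
  "cf a 0 = 0"
| "cf a (Suc n) = 1 / (real (a 0) + cf (\<lambda>i. a (Suc i)) n)"

definition cf_expansion :: "(nat \<Rightarrow> nat) \<Rightarrow> real \<Rightarrow> bool" where
  "cf_expansion a \<alpha> \<longleftrightarrow> (\<forall>i. a i > 0) \<and> cf a \<longlonglongrightarrow> \<alpha>"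

definition BT :: "nat \<Rightarrow> real set" where
  "BT K = {\<alpha>. 0 < \<alpha> \<and> \<alpha> < 1 \<and> \<alpha> \<notin> \<rat> \<and> (\<exists>a. cf_expansion a \<alpha> \<and> (\<forall>i. a i \<le> K))}"

definition conformally_conjugate_to_rot :: "real \<Rightarrow> (cyl \<Rightarrow> cyl) \<Rightarrow> real \<Rightarrow> bool" where
  "conformally_conjugate_to_rot \<epsilon> f \<alpha> \<longleftrightarrow>
     (\<exists>\<xi>. cyl_holomorphic_on \<xi> (strip (\<epsilon> / 2)) \<and> inj_on \<xi> (strip (\<epsilon> / 2)) \<and>
        \<xi> ` strip (\<epsilon> / 2) \<subseteq> strip \<epsilon> \<and>
        (\<forall>p\<in>strip (\<epsilon> / 2). f (\<xi> p) = \<xi> (rot \<alpha> p)))"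

end

theory Submission imports Defs
begin

text \<open>
The conjugacy is produced by Newton's method in the style of Kolmogorov, Arnold and Moser, arranged
so that \<open>f\<close> is never conjugated and no inverse map is needed. On the universal cover \<open>f\<close> becomes
\<open>z + \<alpha> + \<eta> z\<close> with \<open>\<eta>\<close> small, \<open>1\<close>-periodic and real on the real axis. The unknown is a periodic \<open>v\<close>
for which \<open>\<xi> z = z + v z\<close> satisfies \<open>f (\<xi> z) = \<xi> (z + \<alpha>)\<close>; an approximate
solution fails by the defect \<open>E z = v z - v (z + \<alpha>) + \<eta> (z + v z)\<close>.

Differentiating \<open>E\<close> expresses \<open>1 + \<eta>'(\<xi> z)\<close>, times \<open>\<xi>' z\<close>, through \<open>\<xi>' (z + \<alpha>)\<close> and \<open>E' z\<close>. Hence for the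
correction \<open>v + \<xi>' w\<close> the linear part of the new defect collapses to \<open>\<xi>' (z + \<alpha>)\<close> times
\<open>w z - w (z + \<alpha>) + E z / \<xi>' (z + \<alpha>)\<close>, up to the quadratically small term \<open>E' w\<close>. One therefore solves the
cohomological equation \<open>w (z + \<alpha>) - w z = E z / \<xi>' (z + \<alpha>) - c\<close>. Its Fourier solution divides the
\<open>k\<close>-th coefficient by \<open>exp (2 \<pi> i k \<alpha>) - 1\<close>, and bounded type keeps this divisor above a multiple of
\<open>1 / k\<^sup>2\<close> (\<open>small_divisor\<close>), so that a narrowing of the band by \<open>\<sigma>\<close> costs only a factor \<open>1 / \<sigma> ^ 4\<close>
(\<open>cohomological_equation\<close>).

The constant \<open>c\<close> cannot be removed by the equation; it is controlled by the rotation number. If the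
new defect had one sign on the whole real axis, every orbit of \<open>f\<close> would gain a definite amount per
step over the rotation, contradicting \<open>\<rho>(f) = \<alpha>\<close> (\<open>no_drift\<close>). So \<open>c\<close> is at most twice the other,
quadratic, error terms (\<open>drift_constant_small\<close>), and one step replaces a defect \<open>\<delta>\<close> by a constant times
\<open>\<delta> ^ 2 / \<sigma> ^ 8\<close> (\<open>newton_step\<close>). Quadratic convergence beats the powers of \<open>\<sigma>\<close> when the bands shrink
geometrically to half of the original one (\<open>newton_conjugacy\<close>). All bounds depend on \<open>\<alpha>\<close> only through
the small divisor constant, hence only on \<open>\<epsilon>\<close> and \<open>K\<close>. The limit \<open>v\<close> is a contraction with constant \<open>1/2\<close>, which makes
\<open>\<xi>\<close> injective even modulo integers (\<open>conjugacy_descends\<close>).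
\<close>

section \<open>Small divisors for rotation numbers of bounded type\<close>

text \<open>The class underlying \<^const>\<open>BT\<close>, with irrationality and the range of \<open>\<alpha>\<close> left implicit, so that it is
visibly closed under the Gauss map.\<close>
definition bounded_cf :: "nat \<Rightarrow> real \<Rightarrow> bool" where
  "bounded_cf K \<alpha> \<longleftrightarrow> (\<exists>a. cf_expansion a \<alpha> \<and> (\<forall>i. a i \<le> K))"

lemma cf_range:
  assumes "\<And>i. a i > 0"
  shows "0 \<le> cf a n \<and> cf a n \<le> 1"
  using assms
proof (induction n arbitrary: a)
  case (Suc n)
  have "0 \<le> cf (\<lambda>i. a (Suc i)) n" "real (a 0) \<ge> 1"
    using Suc.IH[of "\<lambda>i. a (Suc i)"] Suc.prems by (auto simp: Suc_le_eq)
  then show ?case by simp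
qed simp

text \<open>The tails of the finite continued fractions converge as well, because the limit \<open>\<alpha>\<close> stays above
\<open>1 / (K + 1)\<close> and \<open>1 / x\<close> is continuous there; their limit is the Gauss map image of \<open>\<alpha>\<close>.\<close>
lemma bounded_cf_gauss_map:
  assumes "bounded_cf K \<alpha>"
  obtains m \<beta> where "bounded_cf K \<beta>" "1 \<le> m" "m \<le> K" "0 \<le> \<beta>" "\<beta> \<le> 1" "\<alpha> * (real m + \<beta>) = 1"
proof -
  obtain a where a: "\<And>i. a i > 0" "\<And>i. a i \<le> K" "cf a \<longlonglongrightarrow> \<alpha>"
    using assms by (auto simp: bounded_cf_def cf_expansion_def)
  define c where "c = cf (\<lambda>i. a (Suc i))"
  have c: "0 \<le> c n" "c n \<le> 1" for n
    using cf_range[of "\<lambda>i. a (Suc i)" n] a(1) by (auto simp: c_def)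
  have a0: "1 \<le> real (a 0)" "real (a 0) \<le> real K" using a(1)[of 0] a(2)[of 0] by auto
  have lim: "(\<lambda>n. 1 / (real (a 0) + c n)) \<longlonglongrightarrow> \<alpha>"
    using LIMSEQ_Suc[OF a(3)] by (simp add: c_def)
  have "1 / (real K + 1) \<le> 1 / (real (a 0) + c n)" for n
    using c[of n] a0 by (intro frac_le) auto
  then have "1 / (real K + 1) \<le> \<alpha>" by (intro LIMSEQ_le_const[OF lim]) auto
  then have pos: "\<alpha> > 0" by (smt (verit) divide_pos_pos of_nat_0_le_iff)
  have "(\<lambda>n. 1 / (1 / (real (a 0) + c n)) - real (a 0)) \<longlonglongrightarrow> 1 / \<alpha> - real (a 0)"
    using pos by (intro tendsto_intros lim) auto
  then have climit: "c \<longlonglongrightarrow> 1 / \<alpha> - real (a 0)" by simp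
  have "bounded_cf K (1 / \<alpha> - real (a 0))"
    unfolding bounded_cf_def cf_expansion_def
    using a climit by (intro exI[of _ "\<lambda>i. a (Suc i)"]) (auto simp: c_def)
  moreover have "0 \<le> 1 / \<alpha> - real (a 0)" using c by (intro LIMSEQ_le_const[OF climit]) auto
  moreover have "1 / \<alpha> - real (a 0) \<le> 1" using c by (intro LIMSEQ_le_const2[OF climit]) auto
  ultimately show thesis
    using a(1)[of 0] a(2)[of 0] pos by (intro that[of "1 / \<alpha> - real (a 0)" "a 0"]) (auto simp: field_simps)
qed

lemma bounded_cf_lower:
  assumes "bounded_cf K \<alpha>"
  shows "1 / (real K + 1) \<le> \<alpha>"
proof -
  obtain m \<beta> where m: "1 \<le> m" "m \<le> K" "0 \<le> \<beta>" "\<beta> \<le> 1" "\<alpha> * (real m + \<beta>) = 1"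
    using bounded_cf_gauss_map[OF assms] by blast
  have "real m + \<beta> \<le> real K + 1" "real m + \<beta> > 0" using m by auto
  moreover have "\<alpha> = 1 / (real m + \<beta>)" using m by (simp add: field_simps)
  ultimately show ?thesis by (simp add: frac_le)
qed

lemma bounded_cf_upper:
  assumes "bounded_cf K \<alpha>"
  shows "\<alpha> \<le> (real K + 1) / (real K + 2)"
proof -
  obtain m \<beta> where m: "bounded_cf K \<beta>" "1 \<le> m" "\<alpha> * (real m + \<beta>) = 1"
    using bounded_cf_gauss_map[OF assms] by blast
  have le: "1 + 1 / (real K + 1) \<le> real m + \<beta>"
    using bounded_cf_lower[OF m(1)] m(2) by simp
  have p: "0 < 1 + 1 / (real K + 1)" by (smt (verit) divide_pos_pos of_nat_0_le_iff)
  have "real m + \<beta> \<noteq> 0" using m(3) by auto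
  then have "\<alpha> = 1 / (real m + \<beta>)" using m(3) by (simp add: eq_divide_eq)
  also have "\<dots> \<le> 1 / (1 + 1 / (real K + 1))" using le p by (intro divide_left_mono) auto
  also have "\<dots> = (real K + 1) / (real K + 2)" by (simp add: field_simps)
  finally show ?thesis .
qed

text \<open>A descent along the Gauss map that avoids convergents: if \<open>\<alpha> (m + \<beta>) = 1\<close> then
\<open>k \<alpha> - p = - \<alpha> (p \<beta> - (k - p m))\<close>, and \<open>p < k\<close> unless \<open>k \<alpha> - p\<close> is already large. The sharp exponent
is \<open>1\<close>, but with it the constant deteriorates slightly in every step. The exponent \<open>2\<close> leaves the
room to close the induction with one constant, since \<open>\<alpha>\<close> is bounded away from \<open>1\<close>.\<close>
lemma bounded_cf_diophantine:
  assumes "bounded_cf K \<alpha>" "k \<ge> 1"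
  shows "1 / (2 * (real K + 2)) / real k ^ 2 \<le> \<bar>real k * \<alpha> - of_int p\<bar>"
  using assms
proof (induction k arbitrary: \<alpha> p rule: less_induct)
  case (less k)
  define c where "c = 1 / (2 * (real K + 2))"
  have c0: "c > 0" "c \<le> 1 / 2" by (auto simp: c_def field_simps)
  have k1: "real k \<ge> 1" using less.prems by simp
  show ?case
  proof (cases "\<bar>real k * \<alpha> - of_int p\<bar> < c")
    case False
    have "c / real k ^ 2 \<le> c / 1" using c0 k1 by (intro divide_left_mono) (auto simp: one_le_power)
    then show ?thesis using False by (simp add: c_def)
  next
    case True
    obtain m \<beta> where m: "bounded_cf K \<beta>" "1 \<le> m" "m \<le> K" "0 \<le> \<beta>" "\<beta> \<le> 1" "\<alpha> * (real m + \<beta>) = 1"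
      using bounded_cf_gauss_map[OF less.prems(1)] by blast
    have lo: "2 * c \<le> \<alpha>"
    proof -
      have "2 * c \<le> 1 / (real K + 1)" by (simp add: c_def field_simps)
      then show ?thesis using bounded_cf_lower[OF less.prems(1)] by simp
    qed
    have up: "\<alpha> \<le> 1 - 2 * c"
      using bounded_cf_upper[OF less.prems(1)] by (simp add: c_def field_simps)
    have "2 * c \<le> real k * \<alpha>" using lo k1 c0 mult_mono[of 1 "real k" "2 * c" \<alpha>] by simp
    then have p0: "of_int p > (0::real)" using True c0 by linarith
    have "real k * \<alpha> \<le> real k * (1 - 2 * c)" using up k1 by (intro mult_left_mono) auto
    moreover have "2 * c \<le> real k * (2 * c)" using k1 c0 by simp
    moreover have "real k * (1 - 2 * c) = real k - real k * (2 * c)" by (simp add: algebra_simps)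
    ultimately have "real k * \<alpha> + c < real k" using c0 by linarith
    then have pk: "of_int p < real k" using True by linarith
    define q where "q = nat p"
    have q: "of_int p = real q" "q \<ge> 1" "q < k" "real q \<ge> 1" using p0 pk by (auto simp: q_def)
    have IH: "c / real q ^ 2 \<le> \<bar>real q * \<beta> - of_int (int k - int q * int m)\<bar>"
      using less.IH[OF q(3) m(1) q(2), of "int k - int q * int m"] by (simp only: c_def)
    have "real k * \<alpha> - real q = - \<alpha> * (real q * \<beta> - (real k - real q * real m))"
    proof -
      have "real q = real q * (\<alpha> * (real m + \<beta>))" using m(6) by simp
      then show ?thesis by (simp add: algebra_simps)
    qed
    then have x: "\<bar>real k * \<alpha> - real q\<bar> = \<alpha> * \<bar>real q * \<beta> - (real k - real q * real m)\<bar>"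
      using lo c0 by (simp add: abs_mult)
    (* It remains to see that alpha k^2 >= q^2, which follows from k alpha > q - c and alpha <= 1 - 2 c. *)
    have "\<alpha> * (c / real q ^ 2) \<le> \<bar>real k * \<alpha> - real q\<bar>"
      unfolding x using IH lo c0 by (intro mult_left_mono) auto
    moreover have "c / real k ^ 2 \<le> \<alpha> * (c / real q ^ 2)"
    proof -
      have ge: "real q - c \<le> real k * \<alpha>" using True q(1) by linarith
      have "real q * 1 \<le> real q * real q" using q by (intro mult_left_mono) auto
      then have "2 * c * real q \<le> 2 * c * (real q)^2" using c0 by (simp add: power2_eq_square)
      moreover have "(real q - c)^2 = (1 - 2 * c) * (real q)^2 + (2 * c * (real q)^2 - 2 * c * real q) + c^2"
        by (simp add: power2_eq_square algebra_simps)
      ultimately have "(1 - 2 * c) * (real q)^2 \<le> (real q - c)^2"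
        using zero_le_power2[of c] by linarith
      also have "\<dots> \<le> (real k * \<alpha>)^2" using ge q(4) c0 by (intro power_mono) auto
      finally have *: "(1 - 2 * c) * (real q)^2 \<le> \<alpha> * (\<alpha> * (real k)^2)" by (simp add: power2_eq_square algebra_simps)
      have "\<alpha> * (real q)^2 \<le> (1 - 2 * c) * (real q)^2" using up by (intro mult_right_mono) auto
      then have "\<alpha> * (real q)^2 \<le> \<alpha> * (\<alpha> * (real k)^2)" using * by linarith
      then have "(real q)^2 \<le> \<alpha> * (real k)^2" using lo c0 by (simp add: mult_le_cancel_left)
      then have "c * (real q)^2 \<le> c * (\<alpha> * (real k)^2)" using c0 by simp
      then show ?thesis using q(4) k1 c0 by (simp add: field_simps)
    qed
    ultimately show ?thesis by (simp add: c_def q(1))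
  qed
qed

lemma abs_sin_ge_half:
  assumes "\<bar>y\<bar> \<le> pi / 2"
  shows "\<bar>y\<bar> / 2 \<le> \<bar>sin (y::real)\<bar>"
proof -
  have s: "\<bar>sin y - y\<bar> \<le> \<bar>y\<bar> ^ 3 / 6"
    using Maclaurin_sin_bound[of y 3] by (simp add: numeral_eq_Suc sin_coeff_def)
  have "\<bar>y\<bar> \<le> 8 / 5" using assms pi_less_4 pi_approx by auto
  then have "\<bar>y\<bar> * \<bar>y\<bar> \<le> 8 / 5 * (8 / 5)" by (intro mult_mono) auto
  then have "\<bar>y\<bar> * (\<bar>y\<bar> * \<bar>y\<bar>) \<le> \<bar>y\<bar> * 3" by (intro mult_left_mono) auto
  then have "\<bar>y\<bar> ^ 3 \<le> 3 * \<bar>y\<bar>" by (simp add: power3_eq_cube)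
  then show ?thesis using s by linarith
qed

text \<open>The modulus of \<open>exp (i t) - 1\<close> is \<open>2 \<bar>sin (t / 2)\<bar>\<close>; reducing \<open>k \<alpha>\<close> modulo integers brings the argument into
the range where the sine is comparable to its argument.\<close>
lemma small_divisor:
  fixes k :: int
  assumes "bounded_cf K \<alpha>" "k \<noteq> 0"
  shows "1 / (2 * (real K + 2)) / (of_int k) ^ 2 \<le> norm (exp (2 * of_real pi * \<i> * of_int k * of_real \<alpha>) - 1)"
proof -
  define n where "n = nat \<bar>k\<bar>"
  have n: "n \<ge> 1" "real n = \<bar>of_int k\<bar>" using assms(2) by (auto simp: n_def)
  define p where "p = round (real_of_int k * \<alpha>)"
  define t where "t = real_of_int k * \<alpha> - of_int p"
  have t: "\<bar>t\<bar> \<le> 1 / 2" unfolding t_def p_def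
    using of_int_round_abs_le[of "real_of_int k * \<alpha>"] by (simp add: abs_minus_commute)
  have dio: "1 / (2 * (real K + 2)) / (of_int k) ^ 2 \<le> \<bar>t\<bar>"
  proof (cases "k > 0")
    case True
    then show ?thesis using bounded_cf_diophantine[OF assms(1) n(1), of p] n by (simp add: t_def)
  next
    case False
    then show ?thesis using bounded_cf_diophantine[OF assms(1) n(1), of "-p"] n
      by (simp add: t_def abs_minus_commute)
  qed
  have "exp (2 * of_real pi * \<i> * of_int k * of_real \<alpha>) = exp (\<i> * of_real (2 * pi * t) + \<i> * (of_int p * (of_real pi * 2)))"
    by (simp add: t_def algebra_simps)
  also have "\<dots> = exp (\<i> * of_real (2 * pi * t))" by (rule exp_plus_2pin)
  finally have "norm (exp (2 * of_real pi * \<i> * of_int k * of_real \<alpha>) - 1) = 2 * \<bar>sin (2 * pi * t / 2)\<bar>"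
    by (simp only: dist_exp_i_1)
  also have "\<dots> = 2 * \<bar>sin (pi * t)\<bar>" by simp
  also have "\<dots> \<ge> \<bar>pi * t\<bar>"
    using abs_sin_ge_half[of "pi * t"] t by (simp add: abs_mult)
  finally have "pi * \<bar>t\<bar> \<le> norm (exp (2 * of_real pi * \<i> * of_int k * of_real \<alpha>) - 1)" by (simp add: abs_mult)
  moreover have "1 * \<bar>t\<bar> \<le> pi * \<bar>t\<bar>" using pi_gt3 by (intro mult_right_mono) auto
  ultimately show ?thesis using dio by linarith
qed

section \<open>Fourier series of periodic holomorphic functions on a band\<close>

definition band :: "real \<Rightarrow> complex set" where
  "band r = {z. \<bar>Im z\<bar> < r}"

lemma band_iff: "z \<in> band r \<longleftrightarrow> \<bar>Im z\<bar> < r"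
  by (simp add: band_def)

lemma band_eq_vimage: "band r = Im -` {-r<..<r}"
  by (auto simp: band_def)

lemma open_band [simp, intro]: "open (band r)"
  unfolding band_eq_vimage by (intro open_vimage continuous_intros open_greaterThanLessThan)

lemma convex_band [simp, intro]: "convex (band r)"
proof -
  have "linear Im" by (simp add: bounded_linear.linear bounded_linear_Im)
  then show ?thesis unfolding band_eq_vimage by (intro convex_linear_vimage) auto
qed

lemma connected_band [simp, intro]: "connected (band r)"
  by (simp add: convex_connected)

lemma band_mono: "r \<le> s \<Longrightarrow> band r \<subseteq> band s"
  by (auto simp: band_def)

lemma band_add_real [simp]: "z + of_real x \<in> band r \<longleftrightarrow> z \<in> band r"
  "z + 1 \<in> band r \<longleftrightarrow> z \<in> band r"
  by (auto simp: band_def)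

lemma cnj_band [simp]: "cnj z \<in> band r \<longleftrightarrow> z \<in> band r"
  by (simp add: band_def)

lemma cball_subset_band:
  assumes "z \<in> band r" "r + e \<le> s"
  shows "cball z e \<subseteq> band s"
proof
  fix w assume "w \<in> cball z e"
  then have "\<bar>Im w - Im z\<bar> \<le> e"
    using abs_Im_le_cmod[of "w - z"] by (simp add: dist_norm norm_minus_commute)
  then show "w \<in> band s" using assms by (auto simp: band_def)
qed

definition fmode :: "int \<Rightarrow> complex \<Rightarrow> complex" where
  "fmode k z = exp (2 * of_real pi * \<i> * of_int k * z)"

lemma fmode_0 [simp]: "fmode 0 z = 1"
  by (simp add: fmode_def)

lemma fmode_add: "fmode k (z + w) = fmode k z * fmode k w"
  by (simp add: fmode_def distrib_left exp_add)

lemma fmode_add_index: "fmode (k + l) z = fmode k z * fmode l z"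
  by (simp add: fmode_def distrib_left distrib_right exp_add)

lemma fmode_of_int: "fmode k (of_int n) = 1"
  unfolding fmode_def exp_eq_1 by (auto intro!: exI[of _ "k * n"])

lemma fmode_periodic [simp]: "fmode k (z + 1) = fmode k z"
  using fmode_of_int[of k 1] by (simp add: fmode_add)

lemma norm_fmode: "norm (fmode k z) = exp (- 2 * pi * of_int k * Im z)"
  by (simp add: fmode_def)

lemma fmode_deriv:
  "(fmode k has_field_derivative 2 * of_real pi * \<i> * of_int k * fmode k z) (at z)"
  unfolding fmode_def by (auto intro!: derivative_eq_intros)

lemma fmode_holomorphic: "fmode k holomorphic_on A"
  unfolding fmode_def by (intro holomorphic_intros)

lemma fmode_1_eq_1_iff: "fmode 1 z = 1 \<longleftrightarrow> z \<in> \<int>"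
proof
  assume "fmode 1 z = 1"
  then obtain n :: int where "Im z = 0" "2 * pi * Re z = of_int (2 * n) * pi"
    by (auto simp: fmode_def exp_eq_1)
  then have "z = of_int n" by (simp add: complex_eq_iff)
  then show "z \<in> \<int>" by simp
next
  assume "z \<in> \<int>"
  then show "fmode 1 z = 1" by (auto simp: Ints_def fmode_of_int)
qed

definition periodic_hol :: "real \<Rightarrow> (complex \<Rightarrow> complex) \<Rightarrow> bool" where
  "periodic_hol r g \<longleftrightarrow> g holomorphic_on band r \<and> (\<forall>z\<in>band r. g (z + 1) = g z)"

lemma periodic_hol_subset:
  "periodic_hol s g \<Longrightarrow> r \<le> s \<Longrightarrow> periodic_hol r g"
  unfolding periodic_hol_def using band_mono[of r s] by (auto intro: holomorphic_on_subset)

lemma periodic_hol_add_int: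
  assumes "periodic_hol r g" "z \<in> band r"
  shows "g (z + of_int n) = g z"
proof -
  have nat: "g (z + of_nat n) = g z" if "z \<in> band r" for n z
  proof (induction n)
    case (Suc n)
    have "z + of_nat n \<in> band r" using that by (simp add: band_def)
    then have "g (z + of_nat n + 1) = g (z + of_nat n)"
      using assms(1) by (simp add: periodic_hol_def)
    then show ?case using Suc by (simp add: add_ac)
  qed simp
  show ?thesis
  proof (cases "n \<ge> 0")
    case True
    then show ?thesis using nat[OF assms(2), of "nat n"] by (simp add: of_nat_nat)
  next
    case False
    have "z + of_int n \<in> band r" using assms(2) by (simp add: band_def)
    from nat[OF this, of "nat (- n)"] False show ?thesis by (simp add: of_nat_nat)
  qed
qed

lemma periodic_hol_mult_fmode:
  "periodic_hol r g \<Longrightarrow> periodic_hol r (\<lambda>z. g z * fmode k z)"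
  unfolding periodic_hol_def by (auto intro!: holomorphic_intros fmode_holomorphic)

lemma periodic_hol_fmode: "periodic_hol r (fmode k)"
  by (simp add: periodic_hol_def fmode_holomorphic)

text \<open>The mean over a period, written without integrals: a primitive of a periodic function gains the same
amount over every unit step, at every height of the band. Independence of the height, usually a
shift of contour, is thus built in.\<close>
definition hol_mean :: "real \<Rightarrow> (complex \<Rightarrow> complex) \<Rightarrow> complex" where
  "hol_mean r h = (THE c. \<exists>H. (\<forall>z\<in>band r. (H has_field_derivative h z) (at z)) \<and>
     (\<forall>z\<in>band r. H (z + 1) - H z = c))"

lemma hol_mean_exists:
  assumes "periodic_hol r h"
  obtains H where "\<And>z. z \<in> band r \<Longrightarrow> (H has_field_derivative h z) (at z)"
  using holomorphic_convex_primitive'[of "band r" h] assms at_within_open[OF _ open_band]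
  unfolding periodic_hol_def by (metis convex_band open_band)

lemma zero_deriv_const_on_band:
  assumes "\<And>z. z \<in> band r \<Longrightarrow> (D has_field_derivative 0) (at z)" "z \<in> band r" "w \<in> band r"
  shows "D z = (D w :: complex)"
proof -
  obtain c where "\<And>z. z \<in> band r \<Longrightarrow> D z = c"
    using has_field_derivative_zero_constant[of "band r" D] assms(1)
    by (metis convex_band has_field_derivative_at_within)
  then show ?thesis using assms by simp
qed

lemma hol_mean_eq:
  assumes r: "r > 0" and h: "periodic_hol r h"
    and H: "\<And>z. z \<in> band r \<Longrightarrow> (H has_field_derivative h z) (at z)" and z: "z \<in> band r"
  shows "H (z + 1) - H z = hol_mean r h"
proof -
  have incr: "G (w + 1) - G w = G (v + 1) - G v"
    if G: "\<And>z. z \<in> band r \<Longrightarrow> (G has_field_derivative h z) (at z)"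
      and wv: "w \<in> band r" "v \<in> band r" for G w v
  proof (rule zero_deriv_const_on_band[where D = "\<lambda>w. G (w + 1) - G w", OF _ wv])
    fix u assume u: "u \<in> band r"
    have "((\<lambda>w. G (w + 1)) has_field_derivative h (u + 1)) (at u)"
      using G[of "u + 1"] u by (simp add: DERIV_shift)
    from DERIV_diff[OF this G[OF u]] show "((\<lambda>w. G (w + 1) - G w) has_field_derivative 0) (at u)"
      using h u by (simp add: periodic_hol_def)
  qed
  have "hol_mean r h = H (z + 1) - H z" unfolding hol_mean_def
  proof (rule the_equality)
    show "\<exists>Ha. (\<forall>w\<in>band r. (Ha has_field_derivative h w) (at w)) \<and>
        (\<forall>w\<in>band r. Ha (w + 1) - Ha w = H (z + 1) - H z)"
      using H incr[OF H _ z] by blast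
  next
    fix c assume "\<exists>Ha. (\<forall>w\<in>band r. (Ha has_field_derivative h w) (at w)) \<and>
        (\<forall>w\<in>band r. Ha (w + 1) - Ha w = c)"
    then obtain G where G: "\<And>w. w \<in> band r \<Longrightarrow> (G has_field_derivative h w) (at w)"
      "\<And>w. w \<in> band r \<Longrightarrow> G (w + 1) - G w = c" by blast
    have "G (z + 1) - H (z + 1) = G z - H z"
      by (rule zero_deriv_const_on_band[where D = "\<lambda>w. G w - H w" and r = r])
        (use z in \<open>auto intro: derivative_eq_intros G(1) H\<close>)
    then show "c = H (z + 1) - H z" using G(2)[OF z] by (simp add: algebra_simps)
  qed
  then show ?thesis by simp
qed

lemma hol_mean_cong:
  assumes "r > 0" "periodic_hol r h" "periodic_hol r g" "\<And>z. z \<in> band r \<Longrightarrow> g z = h z"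
  shows "hol_mean r g = hol_mean r h"
proof -
  obtain H where H: "\<And>z. z \<in> band r \<Longrightarrow> (H has_field_derivative h z) (at z)"
    using hol_mean_exists[OF assms(2)] by blast
  have 0: "0 \<in> band r" using assms(1) by (simp add: band_def)
  have "H (0 + 1) - H 0 = hol_mean r g"
    by (rule hol_mean_eq[OF assms(1,3) _ 0]) (simp add: H assms(4))
  then show ?thesis using hol_mean_eq[OF assms(1,2) H 0] by simp
qed

lemma hol_mean_linear:
  assumes r: "r > 0" and h: "periodic_hol r h" "periodic_hol r g"
  shows "hol_mean r (\<lambda>z. a * h z + b * g z) = a * hol_mean r h + b * hol_mean r g"
proof -
  obtain H where H: "\<And>z. z \<in> band r \<Longrightarrow> (H has_field_derivative h z) (at z)"
    using hol_mean_exists[OF h(1)] by blast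
  obtain G where G: "\<And>z. z \<in> band r \<Longrightarrow> (G has_field_derivative g z) (at z)"
    using hol_mean_exists[OF h(2)] by blast
  have 0: "0 \<in> band r" using r by (simp add: band_def)
  have "(a * H (0 + 1) + b * G (0 + 1)) - (a * H 0 + b * G 0) = hol_mean r (\<lambda>z. a * h z + b * g z)"
  proof (rule hol_mean_eq[OF r _ _ 0])
    show "periodic_hol r (\<lambda>z. a * h z + b * g z)"
      using h by (auto simp: periodic_hol_def intro!: holomorphic_intros)
    show "((\<lambda>z. a * H z + b * G z) has_field_derivative a * h z + b * g z) (at z)" if "z \<in> band r" for z
      by (auto intro!: derivative_eq_intros H[OF that] G[OF that])
  qed
  moreover have "(a * H (0 + 1) + b * G (0 + 1)) - (a * H 0 + b * G 0)
      = a * (H (0 + 1) - H 0) + b * (G (0 + 1) - G 0)" by (simp only: algebra_simps)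
  ultimately show ?thesis using hol_mean_eq[OF r h(1) H 0] hol_mean_eq[OF r h(2) G 0] by simp
qed

text \<open>The mean value inequality for the primitive along one horizontal line. The freedom in the height of the line is
what makes Fourier coefficients decay exponentially.\<close>
lemma hol_mean_bound:
  assumes r: "r > 0" and h: "periodic_hol r h" and y: "\<bar>y\<bar> < r"
    and B: "\<And>z. Im z = y \<Longrightarrow> norm (h z) \<le> B"
  shows "norm (hol_mean r h) \<le> B"
proof -
  obtain H where H: "\<And>z. z \<in> band r \<Longrightarrow> (H has_field_derivative h z) (at z)"
    using hol_mean_exists[OF h] by blast
  let ?z = "Complex 0 y" and ?L = "{z. Im z = y}"
  have conv: "convex ?L"
  proof -
    have "linear Im" by (simp add: bounded_linear.linear bounded_linear_Im)
    moreover have "?L = Im -` {y}" by auto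
    ultimately show ?thesis by (metis convex_linear_vimage convex_singleton)
  qed
  have z: "?z \<in> band r" using y by (simp add: band_def)
  have "norm (H (?z + 1) - H ?z) \<le> B * norm (?z + 1 - ?z)"
    by (rule field_differentiable_bound[OF conv, where f' = h])
      (use y B in \<open>auto intro!: has_field_derivative_at_within H simp: band_def\<close>)
  then show ?thesis using hol_mean_eq[OF r h H z] by simp
qed

lemma hol_mean_fmode:
  assumes "r > 0"
  shows "hol_mean r (fmode k) = (if k = 0 then 1 else 0)"
proof -
  have 0: "0 \<in> band r" using assms by (simp add: band_def)
  show ?thesis
  proof (cases "k = 0")
    case True
    have "(0 + 1 :: complex) - 0 = hol_mean r (fmode k)"
      by (rule hol_mean_eq[OF assms periodic_hol_fmode _ 0]) (auto simp: True intro!: derivative_eq_intros)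
    then show ?thesis using True by simp
  next
    case False
    let ?c = "2 * of_real pi * \<i> * of_int k :: complex"
    have c: "?c \<noteq> 0" using False by simp
    have "fmode k (0 + 1) / ?c - fmode k 0 / ?c = hol_mean r (fmode k)"
    proof (rule hol_mean_eq[OF assms periodic_hol_fmode _ 0])
      fix z
      show "((\<lambda>z. fmode k z / ?c) has_field_derivative fmode k z) (at z)"
        using DERIV_cdivide[OF fmode_deriv[of k z], of ?c] c by simp
    qed
    then show ?thesis using False by (simp del: add_0)
  qed
qed

definition fourier_coeff :: "real \<Rightarrow> (complex \<Rightarrow> complex) \<Rightarrow> int \<Rightarrow> complex" where
  "fourier_coeff r g k = hol_mean r (\<lambda>z. g z * fmode (- k) z)"

lemma fourier_coeff_line_bound:
  assumes "r > 0" "periodic_hol r g" "\<bar>y\<bar> < r" "\<And>z. Im z = y \<Longrightarrow> norm (g z) \<le> B"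
  shows "norm (fourier_coeff r g k) \<le> B * exp (2 * pi * of_int k * y)"
  unfolding fourier_coeff_def
proof (rule hol_mean_bound[OF assms(1) periodic_hol_mult_fmode[OF assms(2)] assms(3)])
  fix z assume "Im z = y"
  then show "norm (g z * fmode (- k) z) \<le> B * exp (2 * pi * of_int k * y)"
    using assms(4)[of z] by (simp add: norm_mult norm_fmode mult_right_mono)
qed

text \<open>The line is moved towards the edge of the band on which \<open>exp (- 2 \<pi> i k z)\<close> is small.\<close>
lemma fourier_coeff_decay:
  assumes "periodic_hol r g" "0 \<le> \<rho>" "\<rho> < r" "\<And>z. z \<in> band r \<Longrightarrow> norm (g z) \<le> B"
  shows "norm (fourier_coeff r g k) \<le> B * exp (- 2 * pi * \<bar>of_int k\<bar> * \<rho>)"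
proof -
  define y where "y = (if k \<ge> 0 then - \<rho> else \<rho>)"
  have "norm (fourier_coeff r g k) \<le> B * exp (2 * pi * of_int k * y)"
    by (rule fourier_coeff_line_bound) (use assms in \<open>auto simp: y_def band_def\<close>)
  also have "2 * pi * of_int k * y = - 2 * pi * \<bar>of_int k\<bar> * \<rho>" by (auto simp: y_def)
  finally show ?thesis .
qed

text \<open>The division of \<open>g - g z0\<close> by \<open>exp (2 \<pi> i (z - z0)) - 1\<close>, with the removable singularities at
\<open>z0 + \<int>\<close> filled in. It is the auxiliary function of Chernoff's proof of pointwise convergence of Fourier series.\<close>
definition circle_quotient :: "(complex \<Rightarrow> complex) \<Rightarrow> complex \<Rightarrow> complex \<Rightarrow> complex" where
  "circle_quotient g z0 z = (if fmode 1 (z - z0) = 1 then deriv g z / (2 * of_real pi * \<i>)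
     else (g z - g z0) / (fmode 1 (z - z0) - 1))"

lemma periodic_hol_int_shift:
  assumes "periodic_hol r g" "z \<in> band r" "w - z \<in> \<int>"
  shows "g w = g z"
proof -
  obtain n where "w - z = of_int n" using assms(3) by (auto simp: Ints_def)
  then have "w = z + of_int n" by (simp add: algebra_simps)
  then show ?thesis using periodic_hol_add_int[OF assms(1,2), of n] by simp
qed

lemma deriv_periodic:
  assumes g: "periodic_hol r g" and z: "z \<in> band r"
  shows "deriv g (z + 1) = deriv g z"
proof -
  have "(g has_field_derivative deriv g (z + 1)) (at (z + 1))"
    using g z by (auto simp: periodic_hol_def intro!: holomorphic_derivI[where S = "band r"])
  then have "((\<lambda>w. g (w + 1)) has_field_derivative deriv g (z + 1)) (at z)" by (simp add: DERIV_shift)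
  moreover have "(g has_field_derivative d) (at z)" if "((\<lambda>w. g (w + 1)) has_field_derivative d) (at z)" for d
    using that
    by (rule has_field_derivative_transform_within_open[OF _ open_band z])
      (use g in \<open>auto simp: periodic_hol_def\<close>)
  ultimately show ?thesis by (metis DERIV_imp_deriv)
qed

lemma periodic_hol_deriv:
  "periodic_hol r g \<Longrightarrow> periodic_hol r (deriv g)"
  using deriv_periodic[of r g] by (auto simp: periodic_hol_def intro: holomorphic_deriv)

lemma circle_quotient_mult:
  assumes "periodic_hol r g" "z \<in> band r" "z0 \<in> band r"
  shows "circle_quotient g z0 z * (fmode 1 (z - z0) - 1) = g z - g z0"
  using periodic_hol_int_shift[OF assms(1,3), of z]
  by (auto simp: circle_quotient_def fmode_1_eq_1_iff)

text \<open>Near a zero \<open>a\<close> of the denominator both numerator and denominator are divided by \<open>z - a\<close>; the denominator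
then takes the nonzero value \<open>2 \<pi> i\<close> at \<open>a\<close>, and the unit ball around \<open>a\<close> contains no other zero.\<close>
lemma periodic_hol_circle_quotient:
  assumes g: "periodic_hol r g" and z0: "z0 \<in> band r"
  shows "periodic_hol r (circle_quotient g z0)"
proof -
  have hol: "g holomorphic_on band r" using g by (simp add: periodic_hol_def)
  have "circle_quotient g z0 field_differentiable at a" if a: "a \<in> band r" for a
  proof (cases "fmode 1 (a - z0) = 1")
    case False
    let ?U = "band r \<inter> {z. fmode 1 (z - z0) \<noteq> 1}"
    have "continuous_on UNIV (\<lambda>z. fmode 1 (z - z0))"
      unfolding fmode_def by (intro continuous_intros)
    then have "open {z. fmode 1 (z - z0) \<noteq> 1}"
      by (intro open_Collect_neq continuous_intros)
    then have U: "open ?U" by (intro open_Int) auto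
    have "(\<lambda>z. (g z - g z0) / (fmode 1 (z - z0) - 1)) holomorphic_on ?U"
      unfolding fmode_def
      by (intro holomorphic_intros holomorphic_on_subset[OF hol]) (auto simp: fmode_def)
    then have "circle_quotient g z0 holomorphic_on ?U"
      by (rule holomorphic_transform) (auto simp: circle_quotient_def)
    then show ?thesis
      using U a False by (auto intro: holomorphic_on_imp_differentiable_at)
  next
    case True
    then have int: "a - z0 \<in> \<int>" by (simp add: fmode_1_eq_1_iff)
    have gz0: "g z0 = g a" using periodic_hol_int_shift[OF g z0 int] by simp
    have shift: "fmode 1 (z - z0) = fmode 1 (z - a)" for z
      using fmode_add[of 1 "z - a" "a - z0"] True by simp
    define \<psi> where "\<psi> = (\<lambda>z. fmode 1 (z - a))"
    have psi_a: "\<psi> a = 1" by (simp add: \<psi>_def fmode_def)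
    have psi_hol: "\<psi> holomorphic_on UNIV" unfolding \<psi>_def fmode_def by (intro holomorphic_intros)
    have "(\<psi> has_field_derivative 2 * of_real pi * \<i>) (at a)"
      unfolding \<psi>_def fmode_def by (auto intro!: derivative_eq_intros)
    then have psi': "deriv \<psi> a = 2 * of_real pi * \<i>" by (rule DERIV_imp_deriv)
    let ?P = "\<lambda>z. if z = a then deriv g a else (g z - g a) / (z - a)"
    let ?Q = "\<lambda>z. if z = a then deriv \<psi> a else (\<psi> z - \<psi> a) / (z - a)"
    let ?U = "band r \<inter> ball a 1"
    have ne: "\<psi> z \<noteq> 1" if "z \<in> ball a 1" "z \<noteq> a" for z
    proof
      assume "\<psi> z = 1"
      then have "z - a \<in> \<int>" by (simp add: \<psi>_def fmode_1_eq_1_iff)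
      then obtain n where n: "z - a = of_int n" by (auto simp: Ints_def)
      then have "norm (of_int n :: complex) < 1" using that by (simp add: dist_norm norm_minus_commute flip: n)
      then have "n = 0" by simp
      then show False using n that by simp
    qed
    have "(\<lambda>z. ?P z / ?Q z) holomorphic_on ?U"
    proof (rule holomorphic_on_divide)
      show "?P holomorphic_on ?U"
        by (rule holomorphic_on_subset[OF pole_lemma_open[OF hol open_band]]) auto
      show "?Q holomorphic_on ?U"
        by (rule holomorphic_on_subset[OF pole_lemma_open[OF psi_hol open_UNIV]]) auto
      show "?Q z \<noteq> 0" if "z \<in> ?U" for z
        using ne[of z] that psi_a psi' by auto
    qed
    then have "circle_quotient g z0 holomorphic_on ?U"
    proof (rule holomorphic_transform)
      fix z assume z: "z \<in> ?U"
      show "?P z / ?Q z = circle_quotient g z0 z"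
      proof (cases "z = a")
        case True
        then show ?thesis using psi' int by (simp add: circle_quotient_def fmode_1_eq_1_iff)
      next
        case False
        then show ?thesis using ne[of z] z psi_a gz0
          by (simp add: circle_quotient_def shift flip: \<psi>_def) (simp add: \<psi>_def)
      qed
    qed
    then show ?thesis
      using a by (auto intro: holomorphic_on_imp_differentiable_at[OF _ open_Int[OF open_band open_ball]])
  qed
  then have "circle_quotient g z0 holomorphic_on band r"
    by (auto simp: holomorphic_on_def intro: field_differentiable_at_within)
  moreover have "circle_quotient g z0 (z + 1) = circle_quotient g z0 z" if "z \<in> band r" for z
  proof -
    have "fmode 1 (z + 1 - z0) = fmode 1 (z - z0)"
      using fmode_periodic[of 1 "z - z0"] by (simp add: algebra_simps)
    then show ?thesis using that g deriv_periodic[OF g that]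
      by (simp add: circle_quotient_def periodic_hol_def)
  qed
  ultimately show ?thesis by (simp add: periodic_hol_def)
qed

text \<open>Off the height of \<open>z0\<close> the denominator is bounded below uniformly in \<open>Re z\<close>.\<close>
lemma circle_quotient_line_bound:
  assumes B: "\<And>z. z \<in> band r \<Longrightarrow> norm (g z) \<le> B" and z0: "z0 \<in> band r"
    and y: "\<bar>y\<bar> < r" "y \<noteq> Im z0"
  obtains C where "\<And>z. Im z = y \<Longrightarrow> norm (circle_quotient g z0 z) \<le> C"
proof -
  define d where "d = \<bar>exp (- 2 * pi * (y - Im z0)) - 1\<bar>"
  have d: "d > 0" using y by (simp add: d_def)
  have "norm (circle_quotient g z0 z) \<le> (2 * B) / d" if z: "Im z = y" for z
  proof -
    have "d \<le> norm (fmode 1 (z - z0) - 1)"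
      using norm_triangle_ineq3[of "fmode 1 (z - z0)" 1] z by (simp add: d_def norm_fmode)
    moreover have "norm (g z - g z0) \<le> 2 * B"
      using norm_triangle_ineq4[of "g z" "g z0"] B[OF z0] B[of z] y z by (simp add: band_def)
    moreover have "fmode 1 (z - z0) \<noteq> 1" using calculation(1) d by auto
    moreover have "0 \<le> B" using B[OF z0] norm_ge_zero order_trans by blast
    ultimately show ?thesis
      using d by (simp add: circle_quotient_def norm_divide frac_le)
  qed
  then show thesis by (rule that)
qed

text \<open>Multiplication by \<open>exp (2 \<pi> i (z - z0)) - 1\<close> acts on Fourier coefficients as a difference operator, so
the Fourier series of \<open>g\<close> at \<open>z0\<close> telescopes.\<close>
lemma fourier_coeff_telescope:
  assumes r: "r > 0" and g: "periodic_hol r g" and z0: "z0 \<in> band r"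
  defines "T \<equiv> \<lambda>k. fourier_coeff r (circle_quotient g z0) k * fmode k z0"
  shows "fourier_coeff r g k * fmode k z0 = (if k = 0 then g z0 else 0) + T (k - 1) - T k"
proof -
  let ?h = "circle_quotient g z0"
  note h = periodic_hol_circle_quotient[OF g z0]
  have inv: "fmode (- 1) z0 * fmode 1 z0 = 1" using fmode_add_index[of "-1" 1 z0] by simp
  have "fourier_coeff r g k =
      hol_mean r (\<lambda>z. 1 * (fmode (- 1) z0 * (?h z * fmode (- (k - 1)) z) + (- 1) * (?h z * fmode (- k) z))
        + g z0 * fmode (- k) z)"
    unfolding fourier_coeff_def
  proof (rule hol_mean_cong[OF r _ periodic_hol_mult_fmode[OF g]])
    show "periodic_hol r (\<lambda>z. 1 * (fmode (- 1) z0 * (?h z * fmode (- (k - 1)) z) + (- 1) * (?h z * fmode (- k) z))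
        + g z0 * fmode (- k) z)"
      using h by (auto simp: periodic_hol_def intro!: holomorphic_intros fmode_holomorphic)
    fix z assume z: "z \<in> band r"
    have e1: "fmode 1 (z - z0) = fmode 1 z * fmode (- 1) z0"
      by (simp add: fmode_def right_diff_distrib exp_diff exp_minus divide_inverse)
    have e2: "fmode (- (k - 1)) z = fmode 1 z * fmode (- k) z"
      by (simp flip: fmode_add_index)
    have gz: "g z = ?h z * (fmode 1 z * fmode (- 1) z0 - 1) + g z0"
      using circle_quotient_mult[OF g z z0] by (simp add: e1)
    then show "g z * fmode (- k) z = 1 * (fmode (- 1) z0 * (?h z * fmode (- (k - 1)) z)
        + (- 1) * (?h z * fmode (- k) z)) + g z0 * fmode (- k) z"
      unfolding e2 by (subst gz) (simp add: algebra_simps)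
  qed
  also have "\<dots> = 1 * hol_mean r (\<lambda>z. fmode (- 1) z0 * (?h z * fmode (- (k - 1)) z) + (- 1) * (?h z * fmode (- k) z))
        + g z0 * hol_mean r (fmode (- k))"
    by (rule hol_mean_linear[OF r _ periodic_hol_fmode])
      (use h in \<open>auto simp: periodic_hol_def intro!: holomorphic_intros fmode_holomorphic\<close>)
  also have "hol_mean r (\<lambda>z. fmode (- 1) z0 * (?h z * fmode (- (k - 1)) z) + (- 1) * (?h z * fmode (- k) z))
      = fmode (- 1) z0 * fourier_coeff r ?h (k - 1) + (- 1) * fourier_coeff r ?h k"
    unfolding fourier_coeff_def by (rule hol_mean_linear[OF r periodic_hol_mult_fmode[OF h] periodic_hol_mult_fmode[OF h]])
  finally have *: "fourier_coeff r g k = fmode (- 1) z0 * fourier_coeff r ?h (k - 1) - fourier_coeff r ?h k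
      + g z0 * (if k = 0 then 1 else 0)"
    by (simp add: hol_mean_fmode[OF r])
  have "fmode (k - 1) z0 = fmode (- 1) z0 * fmode k z0"
    by (simp flip: fmode_add_index)
  then show ?thesis unfolding * T_def by (simp add: algebra_simps)
qed

text \<open>By telescoping, the partial sums differ from \<open>g z0\<close> by two boundary terms. They decay geometrically: each is
estimated on a line on the favourable side of \<open>z0\<close>.\<close>
theorem fourier_series_sums:
  assumes r: "r > 0" and g: "periodic_hol r g" and z0: "z0 \<in> band r"
    and B: "\<And>z. z \<in> band r \<Longrightarrow> norm (g z) \<le> B"
  shows "(\<lambda>n. fourier_coeff r g (int (Suc n)) * fmode (int (Suc n)) z0
            + fourier_coeff r g (- int (Suc n)) * fmode (- int (Suc n)) z0)
         sums (g z0 - fourier_coeff r g 0)"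
proof -
  let ?h = "circle_quotient g z0"
  note h = periodic_hol_circle_quotient[OF g z0]
  define T where "T = (\<lambda>k. fourier_coeff r ?h k * fmode k z0)"
  define a where "a = (\<lambda>k. fourier_coeff r g k * fmode k z0)"
  have tel: "a k = (if k = 0 then g z0 else 0) + T (k - 1) - T k" for k
    unfolding a_def T_def by (rule fourier_coeff_telescope[OF r g z0])
  have part: "(\<Sum>n<N. a (int (Suc n)) + a (- int (Suc n))) = g z0 - a 0 + T (- int N - 1) - T (int N)" for N
  proof (induction N)
    case 0
    show ?case using tel[of 0] by simp
  next
    case (Suc N)
    have 1: "a (int (Suc N)) = T (int N) - T (int (Suc N))" using tel[of "int (Suc N)"] by simp
    have e: "- int (Suc N) = - int N - 1" by simp
    have 2: "a (- int (Suc N)) = T (- int (Suc N) - 1) - T (- int N - 1)"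
      unfolding e using tel[of "- int N - 1"] by simp
    show ?case unfolding sum.lessThan_Suc Suc 1 2 by simp
  qed
  have geometric: "(\<lambda>N. C * exp (- 2 * pi * t) ^ N) \<longlonglongrightarrow> 0" if "t > 0" for C t :: real
  proof -
    have "exp (- 2 * pi * t) < 1" using that by simp
    then have "(\<lambda>N. C * exp (- 2 * pi * t) ^ N) \<longlonglongrightarrow> C * 0"
      by (intro tendsto_intros LIMSEQ_realpow_zero) auto
    then show ?thesis by simp
  qed
  have up: "(\<lambda>N. T (int N)) \<longlonglongrightarrow> 0"
  proof -
    (* Any height strictly between -r and Im z0 would do. *)
    define y where "y = (Im z0 - r) / 2"
    have y: "\<bar>y\<bar> < r" "y < Im z0" using z0 by (auto simp: y_def band_def)
    obtain C where C: "\<And>z. Im z = y \<Longrightarrow> norm (?h z) \<le> C"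
      using circle_quotient_line_bound[of r g B z0 y] B z0 y by (metis less_irrefl)
    have le: "norm (T (int N)) \<le> C * exp (- 2 * pi * (Im z0 - y)) ^ N" for N
    proof -
      have "norm (T (int N)) \<le> C * exp (2 * pi * of_int (int N) * y) * exp (- 2 * pi * of_int (int N) * Im z0)"
        unfolding T_def norm_mult norm_fmode
        by (intro mult_right_mono fourier_coeff_line_bound[OF r h y(1) C]) auto
      also have "\<dots> = C * exp (- 2 * pi * (Im z0 - y)) ^ N"
        by (simp add: algebra_simps flip: exp_add exp_of_nat_mult)
      finally show ?thesis .
    qed
    show ?thesis
      by (rule Lim_null_comparison[OF _ geometric[of "Im z0 - y" C]]) (use le y in auto)
  qed
  have down: "(\<lambda>N. T (- int N - 1)) \<longlonglongrightarrow> 0"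
  proof -
    (* Any height strictly between Im z0 and r would do. *)
    define y where "y = (Im z0 + r) / 2"
    have y: "\<bar>y\<bar> < r" "Im z0 < y" using z0 by (auto simp: y_def band_def)
    obtain C where C: "\<And>z. Im z = y \<Longrightarrow> norm (?h z) \<le> C"
      using circle_quotient_line_bound[of r g B z0 y] B z0 y by (metis less_irrefl)
    have le: "norm (T (- int N - 1)) \<le> C * exp (- 2 * pi * (y - Im z0)) ^ Suc N" for N
    proof -
      have "norm (T (- int N - 1)) \<le> C * exp (2 * pi * of_int (- int N - 1) * y) * exp (- 2 * pi * of_int (- int N - 1) * Im z0)"
        unfolding T_def norm_mult norm_fmode
        by (intro mult_right_mono fourier_coeff_line_bound[OF r h y(1) C]) auto
      also have "\<dots> = C * exp (real (Suc N) * (- 2 * pi * (y - Im z0)))"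
        by (simp add: algebra_simps flip: exp_add)
      finally show ?thesis by (simp only: exp_of_nat_mult)
    qed
    show ?thesis
      by (rule Lim_null_comparison[OF _ LIMSEQ_Suc[OF geometric[of "y - Im z0" C]]]) (use le y in auto)
  qed
  have "(\<lambda>N. g z0 - a 0 + T (- int N - 1) - T (int N)) \<longlonglongrightarrow> g z0 - a 0 + 0 - 0"
    by (intro tendsto_intros up down)
  then have "(\<lambda>n. a (int (Suc n)) + a (- int (Suc n))) sums (g z0 - a 0)"
    unfolding sums_def part by simp
  then show ?thesis by (simp add: a_def)
qed

section \<open>The cohomological equation\<close>

text \<open>For holomorphic functions on a band, equivalent to being real on the real axis. In this form the
property passes through compositions, derivatives and limits without the identity theorem.\<close>
definition real_symmetric :: "real \<Rightarrow> (complex \<Rightarrow> complex) \<Rightarrow> bool" where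
  "real_symmetric r g \<longleftrightarrow> (\<forall>z\<in>band r. g (cnj z) = cnj (g z))"

lemma real_symmetric_subset: "real_symmetric s g \<Longrightarrow> r \<le> s \<Longrightarrow> real_symmetric r g"
  unfolding real_symmetric_def using band_mono[of r s] by auto

lemma real_symmetric_of_real:
  assumes "real_symmetric r g" "r > 0"
  shows "g (of_real x) = of_real (Re (g (of_real x)))"
proof -
  have "complex_of_real x \<in> band r" using assms(2) by (simp add: band_def)
  then have "g (cnj (of_real x)) = cnj (g (of_real x))"
    using assms(1) unfolding real_symmetric_def by blast
  then show ?thesis by (simp add: complex_eq_iff)
qed

definition diophantine :: "real \<Rightarrow> real \<Rightarrow> bool" where
  "diophantine D \<alpha> \<longleftrightarrow> D > 0 \<and> (\<forall>k::int. k \<noteq> 0 \<longrightarrow> D / (of_int k)^2 \<le> norm (fmode k (of_real \<alpha>) - 1))"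

text \<open>Exponential decay absorbs the factor \<open>n\<^sup>2\<close> of the small divisor and leaves a summable \<open>1 / n\<^sup>2\<close>, at the price of
\<open>1 / \<sigma> ^ 4\<close>.\<close>
lemma exp_minus_pi_bound:
  assumes "n > 0" "\<sigma> > 0"
  shows "real n ^ 2 * exp (- pi * real n * \<sigma>) \<le> 4 / \<sigma> ^ 4 * (1 / real n ^ 2)"
proof -
  define t where "t = real n * \<sigma>"
  have t: "t > 0" using assms by (simp add: t_def)
  have "3 * t / 4 \<le> 1 + pi * t / 4" using pi_gt3 t mult_right_mono[of 3 pi t] by linarith
  also have "\<dots> \<le> exp (pi * t / 4)" by (rule exp_ge_add_one_self)
  finally have "(3 * t / 4) ^ 4 \<le> exp (pi * t / 4) ^ 4" using t by (intro power_mono) auto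
  also have "\<dots> = exp (pi * t)" by (simp flip: exp_of_nat_mult)
  finally have "81 / 256 * t ^ 4 \<le> exp (pi * t)" by (simp add: power_divide power_mult_distrib)
  moreover have "0 < t ^ 4" using t by simp
  ultimately have "t ^ 4 \<le> 4 * exp (pi * t)" by linarith
  then have "exp (- (pi * t)) \<le> 4 / t ^ 4" using t by (simp add: exp_minus field_simps)
  then have "real n ^ 2 * exp (- (pi * t)) \<le> real n ^ 2 * (4 / t ^ 4)" by (intro mult_left_mono) auto
  also have "\<dots> = 4 / \<sigma> ^ 4 * (1 / real n ^ 2)"
    using assms by (simp add: t_def power_mult_distrib field_simps flip: power_add)
  finally show ?thesis by (simp add: t_def mult_ac)
qed

text \<open>The Fourier coefficients of the solution are those of \<open>g\<close> divided by \<open>exp (2 \<pi> i k \<alpha>) - 1\<close>. Those of \<open>g\<close> decay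
like \<open>exp (- 2 \<pi> \<bar>k\<bar> (r - \<sigma> / 2))\<close>, whereas the exponentials grow at most like \<open>exp (2 \<pi> \<bar>k\<bar> (r - \<sigma>))\<close> on the narrower
band.\<close>
lemma cohomological_equation_complex:
  assumes dio: "diophantine D \<alpha>" and \<sigma>: "0 < \<sigma>" "\<sigma> < r"
    and g: "periodic_hol r g" and B: "\<And>z. z \<in> band r \<Longrightarrow> norm (g z) \<le> B"
  shows "\<exists>w. periodic_hol (r - \<sigma>) w
    \<and> (\<forall>z\<in>band (r - \<sigma>). w (z + of_real \<alpha>) - w z = g z - fourier_coeff r g 0)
    \<and> (\<forall>z\<in>band (r - \<sigma>). norm (w z) \<le> (8 / D * (\<Sum>n. 1 / real (Suc n) ^ 2)) * B / \<sigma> ^ 4)"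
proof -
  have r: "r > 0" using \<sigma> by simp
  have D: "D > 0" and small: "\<And>k. k \<noteq> 0 \<Longrightarrow> D / (of_int k)^2 \<le> norm (fmode k (of_real \<alpha>) - 1)"
    using dio by (auto simp: diophantine_def)
  have "0 \<in> band r" using r by (simp add: band_def)
  from order_trans[OF norm_ge_zero B[OF this]] have B0: "0 \<le> B" .
  define a where "a = fourier_coeff r g"
  define b where "b k = a k / (fmode k (of_real \<alpha>) - 1)" for k
  define u where "u n z = b (int (Suc n)) * fmode (int (Suc n)) z + b (- int (Suc n)) * fmode (- int (Suc n)) z" for n z
  define M where "M n = 8 * B / (D * \<sigma> ^ 4) * (1 / real (Suc n) ^ 2)" for n
  have mode_bound: "norm (b k * fmode k z) \<le> 4 * B / (D * \<sigma> ^ 4) * (1 / real n ^ 2)"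
    if k: "\<bar>k\<bar> = int n" "n > 0" and z: "z \<in> band (r - \<sigma>)" for k n z
  proof -
    have kn: "\<bar>real_of_int k\<bar> = real n" using k by linarith
    then have k2: "(real_of_int k)^2 = (real n)^2" by (metis power2_abs)
    have "norm (a k) \<le> B * exp (- 2 * pi * \<bar>of_int k\<bar> * (r - \<sigma> / 2))"
      unfolding a_def by (rule fourier_coeff_decay[OF g]) (use \<sigma> B in auto)
    then have 1: "norm (a k) \<le> B * exp (- 2 * pi * real n * (r - \<sigma> / 2))" by (simp add: kn)
    have "D / (real n)^2 \<le> norm (fmode k (of_real \<alpha>) - 1)" using small[of k] k k2 by auto
    then have "norm (a k) / norm (fmode k (of_real \<alpha>) - 1)
        \<le> (B * exp (- 2 * pi * real n * (r - \<sigma> / 2))) / (D / (real n)^2)"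
      using 1 D k B0 by (intro frac_le) auto
    then have 2: "norm (b k) \<le> B / D * (real n)^2 * exp (- 2 * pi * real n * (r - \<sigma> / 2))"
      by (simp add: b_def norm_divide mult_ac)
    have "- of_int k * Im z \<le> real n * (r - \<sigma>)"
    proof -
      have "- of_int k * Im z \<le> \<bar>of_int k\<bar> * \<bar>Im z\<bar>"
        by (metis abs_ge_self abs_minus_cancel abs_mult)
      also have "\<dots> \<le> real n * (r - \<sigma>)" unfolding kn using z by (intro mult_left_mono) (auto simp: band_def)
      finally show ?thesis .
    qed
    then have "2 * pi * (- of_int k * Im z) \<le> 2 * pi * (real n * (r - \<sigma>))" by (intro mult_left_mono) auto
    then have 3: "norm (fmode k z) \<le> exp (2 * pi * real n * (r - \<sigma>))" by (simp add: norm_fmode mult_ac)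
    have "norm (b k * fmode k z) \<le> (B / D * (real n)^2 * exp (- 2 * pi * real n * (r - \<sigma> / 2))) * exp (2 * pi * real n * (r - \<sigma>))"
      unfolding norm_mult using 2 3 D B0 by (intro mult_mono) auto
    also have "\<dots> = B / D * ((real n)^2 * exp (- pi * real n * \<sigma>))"
      by (simp add: algebra_simps flip: exp_add)
    also have "\<dots> \<le> B / D * (4 / \<sigma> ^ 4 * (1 / real n ^ 2))"
      using B0 D by (intro mult_left_mono exp_minus_pi_bound k \<sigma>) auto
    finally show ?thesis by (simp add: field_simps)
  qed
  have u_bound: "norm (u n z) \<le> M n" if z: "z \<in> band (r - \<sigma>)" for n z
  proof -
    have "norm (u n z) \<le> norm (b (int (Suc n)) * fmode (int (Suc n)) z) + norm (b (- int (Suc n)) * fmode (- int (Suc n)) z)"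
      unfolding u_def by (rule norm_triangle_ineq)
    also have "\<dots> \<le> 4 * B / (D * \<sigma> ^ 4) * (1 / real (Suc n) ^ 2) + 4 * B / (D * \<sigma> ^ 4) * (1 / real (Suc n) ^ 2)"
      by (intro add_mono mode_bound[OF _ _ z]) auto
    also have "\<dots> = M n" by (simp add: M_def)
    finally show ?thesis .
  qed
  have sq: "summable (\<lambda>n. 1 / real (Suc n) ^ 2)"
    using summable_Suc_iff[of "\<lambda>n. inverse (real n ^ 2)"] inverse_power_summable[of 2, where 'a = real]
    by (simp add: field_simps)
  have M: "summable M" unfolding M_def by (intro summable_mult sq)
  have u_summable: "summable (\<lambda>n. u n z)" if "z \<in> band (r - \<sigma>)" for z
    by (rule summable_comparison_test'[OF M, of 0]) (use u_bound that in auto)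
  define w where "w z = (\<Sum>n. u n z)" for z
  have lim: "uniform_limit (band (r - \<sigma>)) (\<lambda>n z. \<Sum>i<n. u i z) w sequentially"
    unfolding w_def using u_bound M by (rule Weierstrass_m_test)
  have "w holomorphic_on band (r - \<sigma>)"
  proof (rule holomorphic_uniform_sequence[OF open_band])
    show "(\<lambda>z. \<Sum>i<n. u i z) holomorphic_on band (r - \<sigma>)" for n
      unfolding u_def by (intro holomorphic_intros fmode_holomorphic)
    fix z assume "z \<in> band (r - \<sigma>)"
    then obtain d where "d > 0" "cball z d \<subseteq> band (r - \<sigma>)" using open_contains_cball[of "band (r - \<sigma>)"] by auto
    then show "\<exists>d>0. cball z d \<subseteq> band (r - \<sigma>) \<and> uniform_limit (cball z d) (\<lambda>n z. \<Sum>i<n. u i z) w sequentially"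
      using uniform_limit_on_subset[OF lim] by blast
  qed
  then have w: "periodic_hol (r - \<sigma>) w"
    by (simp add: periodic_hol_def w_def u_def)
  have w_eq: "w (z + of_real \<alpha>) - w z = g z - a 0" if z: "z \<in> band (r - \<sigma>)" for z
  proof -
    have mode: "b k * fmode k (z + of_real \<alpha>) - b k * fmode k z = a k * fmode k z" if "k \<noteq> 0" for k
    proof -
      have "0 < D / (real_of_int k)^2" using D that by simp
      then have "fmode k (of_real \<alpha>) - 1 \<noteq> 0" using small[OF that] by auto
      then have "b k * (fmode k (of_real \<alpha>) - 1) = a k" by (simp add: b_def)
      then have "a k * fmode k z = b k * (fmode k (of_real \<alpha>) - 1) * fmode k z" by simp
      then show ?thesis by (simp add: fmode_add algebra_simps)
    qed
    have "z \<in> band r" using z \<sigma> band_mono[of "r - \<sigma>" r] by auto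
    from fourier_series_sums[OF r g this B]
    have "(\<lambda>n. a (int (Suc n)) * fmode (int (Suc n)) z + a (- int (Suc n)) * fmode (- int (Suc n)) z) sums (g z - a 0)"
      by (simp add: a_def)
    moreover have "u n (z + of_real \<alpha>) - u n z = a (int (Suc n)) * fmode (int (Suc n)) z + a (- int (Suc n)) * fmode (- int (Suc n)) z" for n
    proof -
      have "int (Suc n) \<noteq> 0" "- int (Suc n) \<noteq> 0" by simp_all
      from this[THEN mode, symmetric] show ?thesis unfolding u_def by (simp only: add_diff_add)
    qed
    moreover have "(\<lambda>n. u n (z + of_real \<alpha>) - u n z) sums (w (z + of_real \<alpha>) - w z)"
      unfolding w_def using u_summable[of z] u_summable[of "z + of_real \<alpha>"] z
      by (intro sums_diff summable_sums) auto
    ultimately show ?thesis using sums_unique2 by force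
  qed
  have w_bound: "norm (w z) \<le> (8 / D * (\<Sum>n. 1 / real (Suc n) ^ 2)) * B / \<sigma> ^ 4" if z: "z \<in> band (r - \<sigma>)" for z
  proof -
    have "norm (w z) \<le> suminf M"
      unfolding w_def by (rule norm_suminf_le[OF u_bound[OF z] M])
    also have "\<dots> = 8 * B / (D * \<sigma> ^ 4) * (\<Sum>n. 1 / real (Suc n) ^ 2)"
      unfolding M_def by (rule suminf_mult[OF sq])
    finally show ?thesis by (simp add: field_simps)
  qed
  show ?thesis using w w_eq w_bound unfolding a_def by blast
qed

lemma holomorphic_cnj_cnj_band:
  "g holomorphic_on band r \<Longrightarrow> (\<lambda>z. cnj (g (cnj z))) holomorphic_on band r"
  using holomorphic_on_compose_cnj_cnj[of g "band r"]
  by (simp add: o_def image_cnj_conv_vimage_cnj vimage_def)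

text \<open>The real version is obtained by averaging a solution with its reflection in the real axis. The
constant \<open>C\<close> depends only on the small divisor constant, which is what makes the final threshold uniform
in \<open>\<alpha>\<close>.\<close>
lemma cohomological_equation:
  fixes D :: real
  obtains C where "C \<ge> 1"
    "\<And>\<alpha> r \<sigma> g B. \<lbrakk>diophantine D \<alpha>; 0 < \<sigma>; \<sigma> < r; periodic_hol r g; real_symmetric r g; \<And>z. z \<in> band r \<Longrightarrow> norm (g z) \<le> B\<rbrakk> \<Longrightarrow>
      \<exists>w c. periodic_hol (r - \<sigma>) w \<and> real_symmetric (r - \<sigma>) w
        \<and> (\<forall>z\<in>band (r - \<sigma>). w (z + of_real \<alpha>) - w z = g z - of_real c)
        \<and> (\<forall>z\<in>band (r - \<sigma>). norm (w z) \<le> C * B / \<sigma> ^ 4)"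
proof -
  define C0 where "C0 = 8 / D * (\<Sum>n. 1 / real (Suc n) ^ 2)"
  have main: "\<exists>w c. periodic_hol (r - \<sigma>) w \<and> real_symmetric (r - \<sigma>) w
        \<and> (\<forall>z\<in>band (r - \<sigma>). w (z + of_real \<alpha>) - w z = g z - of_real c)
        \<and> (\<forall>z\<in>band (r - \<sigma>). norm (w z) \<le> max 1 C0 * B / \<sigma> ^ 4)"
    if dio: "diophantine D \<alpha>" and \<sigma>: "0 < \<sigma>" "\<sigma> < r" and g: "periodic_hol r g" "real_symmetric r g"
      and B: "\<And>z. z \<in> band r \<Longrightarrow> norm (g z) \<le> B" for \<alpha> r \<sigma> g B
  proof -
    let ?b = "band (r - \<sigma>)"
    obtain w0 where w0: "periodic_hol (r - \<sigma>) w0"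
      "\<And>z. z \<in> ?b \<Longrightarrow> w0 (z + of_real \<alpha>) - w0 z = g z - fourier_coeff r g 0"
      "\<And>z. z \<in> ?b \<Longrightarrow> norm (w0 z) \<le> C0 * B / \<sigma> ^ 4"
      using cohomological_equation_complex[OF dio \<sigma> g(1) B] unfolding C0_def by blast
    have "0 \<in> band r" using \<sigma> by (simp add: band_def)
    from order_trans[OF norm_ge_zero B[OF this]] have B0: "0 \<le> B" .
    define w where "w z = (w0 z + cnj (w0 (cnj z))) / 2" for z
    have "periodic_hol (r - \<sigma>) w"
    proof -
      have "w0 holomorphic_on ?b" using w0 by (simp add: periodic_hol_def)
      then have "w holomorphic_on ?b" unfolding w_def
        by (intro holomorphic_intros holomorphic_cnj_cnj_band) auto
      moreover have "w0 (cnj z + 1) = w0 (cnj z)" if "z \<in> ?b" for z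
        using w0(1) that by (simp add: periodic_hol_def)
      ultimately show ?thesis using w0(1) by (simp add: periodic_hol_def w_def)
    qed
    moreover have "real_symmetric (r - \<sigma>) w" by (simp add: real_symmetric_def w_def add.commute)
    moreover have "w (z + of_real \<alpha>) - w z = g z - of_real (Re (fourier_coeff r g 0))" if z: "z \<in> ?b" for z
    proof -
      have "g (cnj z) = cnj (g z)" using g(2) z \<sigma> by (auto simp: real_symmetric_def band_def)
      then have "w0 (cnj z + of_real \<alpha>) - w0 (cnj z) = cnj (g z) - fourier_coeff r g 0"
        using w0(2)[of "cnj z"] z by simp
      then have "cnj (w0 (cnj z + of_real \<alpha>)) - cnj (w0 (cnj z)) = g z - cnj (fourier_coeff r g 0)"
        by (metis complex_cnj_cnj complex_cnj_diff)
      moreover have "2 * (w (z + of_real \<alpha>) - w z) = (w0 (z + of_real \<alpha>) - w0 z)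
          + (cnj (w0 (cnj z + of_real \<alpha>)) - cnj (w0 (cnj z)))"
        by (simp add: w_def field_simps)
      ultimately have "2 * (w (z + of_real \<alpha>) - w z) = 2 * g z - (fourier_coeff r g 0 + cnj (fourier_coeff r g 0))"
        using w0(2)[OF z] by simp
      then have "2 * (w (z + of_real \<alpha>) - w z) = 2 * (g z - of_real (Re (fourier_coeff r g 0)))"
        by (simp add: complex_add_cnj right_diff_distrib)
      then show ?thesis by (simp only: mult_cancel_left) simp
    qed
    moreover have "norm (w z) \<le> max 1 C0 * B / \<sigma> ^ 4" if z: "z \<in> ?b" for z
    proof -
      have "norm (w z) \<le> (norm (w0 z) + norm (w0 (cnj z))) / 2"
        using norm_triangle_ineq[of "w0 z" "cnj (w0 (cnj z))"] by (simp add: w_def norm_divide)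
      also have "\<dots> \<le> C0 * B / \<sigma> ^ 4"
      proof -
        have "(s + t) / 2 \<le> u" if "s \<le> u" "t \<le> u" for s t u :: real using that by simp
        then show ?thesis using w0(3)[OF z] w0(3)[of "cnj z", unfolded cnj_band, OF z] by blast
      qed
      also have "\<dots> \<le> max 1 C0 * B / \<sigma> ^ 4"
        using B0 \<sigma> by (intro divide_right_mono mult_right_mono) auto
      finally show ?thesis .
    qed
    ultimately show ?thesis by blast
  qed
  show thesis by (rule that[of "max 1 C0"]) (use main in auto)
qed

lemma deriv_bound_band:
  assumes "g holomorphic_on band r" "\<And>z. z \<in> band r \<Longrightarrow> norm (g z) \<le> B" "\<sigma> > 0" "z \<in> band (r - \<sigma>)"
  shows "norm (deriv g z) \<le> B / \<sigma>"
proof -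
  have sub: "cball z \<sigma> \<subseteq> band r" using assms(4) by (rule cball_subset_band) simp
  have "norm ((deriv ^^ 1) g z) \<le> fact 1 * B / \<sigma> ^ 1"
  proof (rule Cauchy_inequality)
    show "g holomorphic_on ball z \<sigma>"
      using assms(1) sub by (meson ball_subset_cball holomorphic_on_subset order_trans)
    show "continuous_on (cball z \<sigma>) g"
      using assms(1) sub by (meson continuous_on_subset holomorphic_on_imp_continuous_on)
    show "norm (g x) \<le> B" if "norm (z - x) = \<sigma>" for x
      using sub that by (intro assms(2)) (auto simp: dist_norm subset_iff)
  qed (use assms in auto)
  then show ?thesis by simp
qed

lemma real_symmetric_deriv:
  assumes g: "g holomorphic_on band r" and sym: "real_symmetric r g"
  shows "real_symmetric r (deriv g)"
  unfolding real_symmetric_def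
proof
  fix z assume z: "z \<in> band r"
  have d: "(g has_field_derivative deriv g z) (at z)"
    by (rule holomorphic_derivI[OF g _ z]) simp
  then have "((\<lambda>w. cnj (g (cnj w))) has_field_derivative cnj (deriv g z)) (at (cnj z))"
    using has_field_derivative_cnj_cnj[of g "deriv g z" "cnj z"] by (simp add: o_def)
  then have "(g has_field_derivative cnj (deriv g z)) (at (cnj z))"
    by (rule has_field_derivative_transform_within_open[where S = "band r"])
      (use z sym in \<open>auto simp: real_symmetric_def\<close>)
  then show "deriv g (cnj z) = cnj (deriv g z)" by (rule DERIV_imp_deriv)
qed

lemma lipschitz_on_band:
  assumes "g holomorphic_on band r" "\<And>z. z \<in> band r \<Longrightarrow> norm (deriv g z) \<le> B" "x \<in> band r" "y \<in> band r"
  shows "norm (g x - g y) \<le> B * norm (x - y)"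
proof (rule field_differentiable_bound[OF convex_band _ _ assms(3,4), where f' = "deriv g"])
  fix z assume z: "z \<in> band r"
  show "(g has_field_derivative deriv g z) (at z within band r)"
    using holomorphic_derivI[OF assms(1) open_band z] by (rule has_field_derivative_at_within)
  show "norm (deriv g z) \<le> B" by (rule assms(2)[OF z])
qed

lemma quadratic_taylor_bound:
  assumes g: "g holomorphic_on band r" and B: "\<And>z. z \<in> band r \<Longrightarrow> norm (g z) \<le> B"
    and \<sigma>: "\<sigma> > 0" and a: "a \<in> band (r - 2 * \<sigma>)" and b: "b \<in> band (r - 2 * \<sigma>)"
  shows "norm (g b - g a - deriv g a * (b - a)) \<le> B / \<sigma>^2 * norm (b - a)^2"
proof -
  have 1: "norm (deriv g z) \<le> B / \<sigma>" if "z \<in> band (r - \<sigma>)" for z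
    using deriv_bound_band[OF g B \<sigma> that] .
  have g1: "deriv g holomorphic_on band r" using g by (intro holomorphic_deriv) auto
  have 2: "norm (deriv (deriv g) z) \<le> B / \<sigma> ^ 2" if "z \<in> band (r - 2 * \<sigma>)" for z
    using deriv_bound_band[of "deriv g" "r - \<sigma>" "B / \<sigma>" \<sigma> z] g1 1 \<sigma> that
      holomorphic_on_subset[OF g1 band_mono[of "r - \<sigma>" r]]
    by (simp add: power2_eq_square)
  have sub: "band (r - 2 * \<sigma>) \<subseteq> band r" using \<sigma> by (intro band_mono) simp
  have "norm ((deriv ^^ 0) g b - (\<Sum>i\<le>1. (deriv ^^ i) g a * (b - a) ^ i / fact i)) \<le> B / \<sigma>^2 * norm (b - a) ^ Suc 1 / fact 1"
  proof (rule complex_Taylor[OF convex_band _ _ a b])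
    fix i z assume "z \<in> band (r - 2 * \<sigma>)"
    then have z: "z \<in> band r" using sub by auto
    show "((deriv ^^ i) g has_field_derivative (deriv ^^ Suc i) g z) (at z within band (r - 2 * \<sigma>))"
      using holomorphic_derivI[OF holomorphic_higher_deriv[OF g open_band, of i] open_band z]
      by (simp add: has_field_derivative_at_within)
  next
    fix z assume "z \<in> band (r - 2 * \<sigma>)"
    then show "norm ((deriv ^^ Suc 1) g z) \<le> B / \<sigma>^2" using 2 by simp
  qed
  moreover have "(\<Sum>i\<le>1. (deriv ^^ i) g a * (b - a) ^ i / fact i) = g a + deriv g a * (b - a)"
    by simp
  ultimately show ?thesis by (simp add: numeral_2_eq_2 diff_diff_eq)
qed

section \<open>One Newton step\<close>

text \<open>The defect \<open>f (\<xi> z) - \<xi> (z + \<alpha>)\<close> for \<open>f z = z + \<alpha> + \<eta> z\<close> and \<open>\<xi> z = z + v z\<close>.\<close>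
definition conj_error :: "real \<Rightarrow> (complex \<Rightarrow> complex) \<Rightarrow> (complex \<Rightarrow> complex) \<Rightarrow> complex \<Rightarrow> complex" where
  "conj_error \<alpha> \<eta> v z = v z - v (z + of_real \<alpha>) + \<eta> (z + v z)"

text \<open>The form in which the Newton step uses that the rotation number is \<open>\<alpha>\<close>: for real \<open>v\<close>, the defect is
not bounded away from \<open>0\<close> with a constant sign on the real axis.\<close>
definition no_drift :: "real \<Rightarrow> (complex \<Rightarrow> complex) \<Rightarrow> bool" where
  "no_drift \<alpha> \<eta> \<longleftrightarrow> (\<forall>v::real \<Rightarrow> real. \<forall>\<mu>>0. (\<forall>x y. \<bar>v x - v y\<bar> \<le> \<bar>x - y\<bar>) \<longrightarrow> bounded (range v) \<longrightarrow>
     (\<exists>x. v x - v (x + \<alpha>) + Re (\<eta> (of_real (x + v x))) < \<mu>) \<and>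
     (\<exists>x. - \<mu> < v x - v (x + \<alpha>) + Re (\<eta> (of_real (x + v x)))))"

lemma shift_in_band:
  assumes "z \<in> band r" "norm w \<le> b" "r + b \<le> s"
  shows "z + w \<in> band s"
  using assms abs_Im_le_cmod[of w] by (auto simp: band_def)

lemma holomorphic_shift_real:
  assumes "g holomorphic_on band r"
  shows "(\<lambda>z. g (z + of_real a)) holomorphic_on band r"
proof -
  have "(\<lambda>z. z + of_real a) holomorphic_on band r" by (intro holomorphic_intros)
  moreover have "(\<lambda>z. z + of_real a) ` band r \<subseteq> band r" by auto
  ultimately show ?thesis
    using holomorphic_on_compose_gen[OF _ assms] by (force simp: o_def)
qed

lemma periodic_hol_conj_error:
  assumes v: "periodic_hol r v" "\<And>z. z \<in> band r \<Longrightarrow> norm (v z) \<le> b" "r + b \<le> s" and \<eta>: "periodic_hol s \<eta>"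
  shows "periodic_hol r (conj_error \<alpha> \<eta> v)"
proof -
  have hv: "v holomorphic_on band r" using v by (simp add: periodic_hol_def)
  have in_s: "z + v z \<in> band s" if "z \<in> band r" for z
    using shift_in_band[OF that v(2)[OF that] v(3)] .
  have "(\<lambda>z. v (z + of_real \<alpha>)) holomorphic_on band r"
    by (rule holomorphic_shift_real[OF hv])
  moreover have "(\<lambda>z. \<eta> (z + v z)) holomorphic_on band r"
  proof -
    have "(\<lambda>z. z + v z) holomorphic_on band r" by (intro holomorphic_intros hv)
    moreover have "\<eta> holomorphic_on band s" using \<eta> by (simp add: periodic_hol_def)
    moreover have "(\<lambda>z. z + v z) ` band r \<subseteq> band s" using in_s by auto
    ultimately show ?thesis using holomorphic_on_compose_gen[of "\<lambda>z. z + v z" "band r" \<eta> "band s"]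
      by (simp add: o_def)
  qed
  ultimately have "conj_error \<alpha> \<eta> v holomorphic_on band r"
    unfolding conj_error_def by (intro holomorphic_intros hv)
  moreover have "conj_error \<alpha> \<eta> v (z + 1) = conj_error \<alpha> \<eta> v z" if z: "z \<in> band r" for z
  proof -
    have 1: "v (z + 1) = v z" using v(1) z by (simp add: periodic_hol_def)
    have "v (z + of_real \<alpha> + 1) = v (z + of_real \<alpha>)" using v(1) z by (simp add: periodic_hol_def)
    then have 2: "v (z + 1 + of_real \<alpha>) = v (z + of_real \<alpha>)" by (simp add: add_ac)
    have "\<eta> (z + v z + 1) = \<eta> (z + v z)" using \<eta> in_s[OF z] by (simp add: periodic_hol_def)
    then have 3: "\<eta> (z + 1 + v z) = \<eta> (z + v z)" by (simp add: add_ac)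
    show ?thesis by (simp add: conj_error_def 1 2 3)
  qed
  ultimately show ?thesis by (simp add: periodic_hol_def)
qed

lemma real_symmetric_conj_error:
  assumes v: "real_symmetric r v" "\<And>z. z \<in> band r \<Longrightarrow> norm (v z) \<le> b" "r + b \<le> s" and \<eta>: "real_symmetric s \<eta>"
  shows "real_symmetric r (conj_error \<alpha> \<eta> v)"
  unfolding real_symmetric_def
proof
  fix z assume z: "z \<in> band r"
  have "z + v z \<in> band s" using shift_in_band[OF z v(2)[OF z] v(3)] .
  then have "\<eta> (cnj (z + v z)) = cnj (\<eta> (z + v z))" using \<eta> by (simp add: real_symmetric_def del: complex_cnj_add)
  moreover have "v (cnj (z + of_real \<alpha>)) = cnj (v (z + of_real \<alpha>))"
    using v(1) z by (simp add: real_symmetric_def del: complex_cnj_add)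
  moreover have "v (cnj z) = cnj (v z)" using v(1) z by (simp add: real_symmetric_def)
  ultimately show "conj_error \<alpha> \<eta> v (cnj z) = cnj (conj_error \<alpha> \<eta> v z)"
    by (simp add: conj_error_def)
qed

text \<open>The source of the cancellation in the Newton step: it expresses
\<open>(1 + \<eta>'(\<xi> z)) \<xi>' z\<close> through \<open>\<xi>' (z + \<alpha>)\<close> and the derivative of the defect.\<close>
lemma deriv_conj_error:
  assumes v: "v holomorphic_on band r" "\<And>z. z \<in> band r \<Longrightarrow> norm (v z) \<le> b" "r + b \<le> s"
    and \<eta>: "\<eta> holomorphic_on band s" and z: "z \<in> band r"
  shows "deriv (conj_error \<alpha> \<eta> v) z = deriv v z - deriv v (z + of_real \<alpha>) + deriv \<eta> (z + v z) * (1 + deriv v z)"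
proof (rule DERIV_imp_deriv)
  have 1: "(v has_field_derivative deriv v z) (at z)"
    by (rule holomorphic_derivI[OF v(1) open_band z])
  have "z + of_real \<alpha> \<in> band r" using z by simp
  then have 2: "((\<lambda>z. v (z + of_real \<alpha>)) has_field_derivative deriv v (z + of_real \<alpha>)) (at z)"
    by (intro DERIV_shift[THEN iffD1] holomorphic_derivI[OF v(1) open_band])
  have "z + v z \<in> band s" using shift_in_band[OF z v(2)[OF z] v(3)] .
  from holomorphic_derivI[OF \<eta> open_band this]
  have 3: "((\<lambda>z. \<eta> (z + v z)) has_field_derivative deriv \<eta> (z + v z) * (1 + deriv v z)) (at z)"
    by (rule DERIV_chain2) (auto intro!: derivative_eq_intros 1)
  show "(conj_error \<alpha> \<eta> v has_field_derivative
      deriv v z - deriv v (z + of_real \<alpha>) + deriv \<eta> (z + v z) * (1 + deriv v z)) (at z)"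
    unfolding conj_error_def[abs_def] by (intro derivative_intros 1 2 3)
qed

text \<open>If \<open>c\<close> exceeded \<open>2 R\<close> in absolute value, then \<open>c s\<close>, of size at least \<open>\<bar>c\<bar> / 2\<close>, would dominate the
remainder \<open>R\<close> and give the defect of \<open>v\<close> a constant sign on the real axis.\<close>
lemma drift_constant_small:
  assumes nd: "no_drift \<alpha> \<eta>" and r: "r > 0" and v: "periodic_hol r v" "real_symmetric r v"
    and vb: "\<And>z. z \<in> band r \<Longrightarrow> norm (v z) \<le> b" and vd: "\<And>z. z \<in> band r \<Longrightarrow> norm (deriv v z) \<le> 1"
    and s: "\<And>x::real. 1 / 2 \<le> Re (s (of_real x))"
    and E: "\<And>x::real. norm (conj_error \<alpha> \<eta> v (of_real x) - of_real c * s (of_real x)) \<le> R"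
  shows "\<bar>c\<bar> \<le> 2 * R"
proof (rule ccontr)
  assume big: "\<not> \<bar>c\<bar> \<le> 2 * R"
  define u where "u x = Re (v (of_real x))" for x :: real
  have real_band: "complex_of_real x \<in> band r" for x using r by (simp add: band_def)
  have vu: "v (of_real x) = of_real (u x)" for x
    unfolding u_def by (rule real_symmetric_of_real[OF v(2) r])
  have hv: "v holomorphic_on band r" using v by (simp add: periodic_hol_def)
  have lip: "\<bar>u x - u y\<bar> \<le> \<bar>x - y\<bar>" for x y
  proof -
    have "norm (v (of_real x) - v (of_real y)) \<le> 1 * norm (complex_of_real x - of_real y)"
      by (rule lipschitz_on_band[OF hv vd real_band real_band])
    then show ?thesis by (simp add: vu flip: of_real_diff)
  qed
  have "norm (u x) \<le> b" for x using vb[OF real_band, of x] by (simp add: vu)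
  then have bdd: "bounded (range u)" by (auto simp: bounded_iff)
  define e where "e x = u x - u (x + \<alpha>) + Re (\<eta> (of_real (x + u x)))" for x
  have e: "e x = Re (conj_error \<alpha> \<eta> v (of_real x))" for x
    using vu[of "x + \<alpha>"] by (simp add: e_def conj_error_def vu)
  have close: "\<bar>e x - c * Re (s (of_real x))\<bar> \<le> R" for x
    using abs_Re_le_cmod[of "conj_error \<alpha> \<eta> v (of_real x) - of_real c * s (of_real x)"] E[of x]
    by (simp add: e)
  define \<mu> where "\<mu> = \<bar>c\<bar> / 2 - R"
  have mu: "\<mu> > 0" using big by (simp add: \<mu>_def)
  obtain x1 x2 where x: "e x1 < \<mu>" "- \<mu> < e x2"
    using nd[unfolded no_drift_def, rule_format, of \<mu> u] lip bdd mu unfolding e_def by blast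
  show False
  proof (cases "c > 0")
    case True
    then have "c * (1 / 2) \<le> c * Re (s (of_real x1))" using s by (intro mult_left_mono) auto
    then show False using close[of x1] x(1) True unfolding \<mu>_def by linarith
  next
    case False
    then have "c * Re (s (of_real x2)) \<le> c * (1 / 2)" using s by (intro mult_left_mono_neg) auto
    then show False using close[of x2] x(2) False unfolding \<mu>_def by linarith
  qed
qed

lemma power_le_shorter:
  assumes "0 < \<sigma>" "\<sigma> \<le> (1::real)" "m \<le> n" "0 \<le> a"
  shows "a / \<sigma> ^ m \<le> a / \<sigma> ^ n"
  using assms by (intro divide_left_mono power_decreasing) auto

text \<open>The band is narrowed twice by \<open>\<sigma>\<close>: once for solving the cohomological equation and
bounding the derivative of the old defect, and once for bounding the derivative of the correction. The bounds
\<open>\<epsilon> / 8\<close> on \<open>v\<close> and \<open>5 \<epsilon> / 8\<close> on the band keep the image of \<open>\<xi>\<close> in the band of half-width \<open>3 \<epsilon> / 4\<close>, where the second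
derivative of \<open>\<eta>\<close> is at most \<open>64 / \<epsilon>\<^sup>2\<close>; the bound \<open>1 / 2\<close> on the derivative of \<open>v\<close> allows division by \<open>\<xi>'\<close>.\<close>
lemma newton_step:
  assumes eps: "\<epsilon> > 0" and \<eta>: "periodic_hol \<epsilon> \<eta>" "real_symmetric \<epsilon> \<eta>" "\<And>z. z \<in> band \<epsilon> \<Longrightarrow> norm (\<eta> z) \<le> 1"
    and nd: "no_drift \<alpha> \<eta>"
    and C: "C \<ge> 1"
    and cohom: "\<And>r \<sigma> g B. \<lbrakk>0 < \<sigma>; \<sigma> < r; periodic_hol r g; real_symmetric r g; \<And>z. z \<in> band r \<Longrightarrow> norm (g z) \<le> B\<rbrakk> \<Longrightarrow>
      \<exists>w c. periodic_hol (r - \<sigma>) w \<and> real_symmetric (r - \<sigma>) w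
        \<and> (\<forall>z\<in>band (r - \<sigma>). w (z + of_real \<alpha>) - w z = g z - of_real c)
        \<and> (\<forall>z\<in>band (r - \<sigma>). norm (w z) \<le> C * B / \<sigma> ^ 4)"
    and v: "periodic_hol r v" "real_symmetric r v"
    and vb: "\<And>z. z \<in> band r \<Longrightarrow> norm (v z) \<le> b" and vd: "\<And>z. z \<in> band r \<Longrightarrow> norm (deriv v z) \<le> d"
    and vE: "\<And>z. z \<in> band r \<Longrightarrow> norm (conj_error \<alpha> \<eta> v z) \<le> \<delta>"
    and \<sigma>: "0 < \<sigma>" "\<sigma> \<le> 1" "2 * \<sigma> < r" and r: "r \<le> 5 * \<epsilon> / 8"
    and small_b: "b + 3 * C * \<delta> / \<sigma> ^ 4 \<le> \<epsilon> / 8" and small_d: "d + 3 * C * \<delta> / \<sigma> ^ 5 \<le> 1 / 2"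
  obtains v1 where "periodic_hol (r - 2 * \<sigma>) v1" "real_symmetric (r - 2 * \<sigma>) v1"
    "\<And>z. z \<in> band (r - 2 * \<sigma>) \<Longrightarrow> norm (v1 z - v z) \<le> 3 * C * \<delta> / \<sigma> ^ 4"
    "\<And>z. z \<in> band (r - 2 * \<sigma>) \<Longrightarrow> norm (deriv v1 z) \<le> d + 3 * C * \<delta> / \<sigma> ^ 5"
    "\<And>z. z \<in> band (r - 2 * \<sigma>) \<Longrightarrow>
       norm (conj_error \<alpha> \<eta> v1 z) \<le> 4 * (2 * C + 9 * C^2 * (64 / \<epsilon>^2)) * \<delta>^2 / \<sigma> ^ 8"
proof -
  let ?e = "conj_error \<alpha> \<eta> v"
  have r0: "r > 0" using \<sigma> by simp
  then have 0: "0 \<in> band r" by (simp add: band_def)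
  have \<delta>0: "0 \<le> \<delta>" using order_trans[OF norm_ge_zero vE[OF 0]] .
  have b0: "0 \<le> b" using order_trans[OF norm_ge_zero vb[OF 0]] .
  have d0: "0 \<le> d" using order_trans[OF norm_ge_zero vd[OF 0]] .
  have t4: "0 \<le> 3 * C * \<delta> / \<sigma> ^ 4" and t5: "0 \<le> 3 * C * \<delta> / \<sigma> ^ 5" using C \<delta>0 \<sigma> by auto
  have b8: "b \<le> \<epsilon> / 8" and d2: "d \<le> 1 / 2" using small_b small_d t4 t5 by linarith+
  have rb: "r + b \<le> \<epsilon>" using r b8 eps by simp
  have hv: "v holomorphic_on band r" and hn: "\<eta> holomorphic_on band \<epsilon>" using v \<eta> by (auto simp: periodic_hol_def)
  have pe: "periodic_hol r ?e" by (rule periodic_hol_conj_error[OF v(1) vb rb \<eta>(1)])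
  have se: "real_symmetric r ?e" by (rule real_symmetric_conj_error[OF v(2) vb rb \<eta>(2)])
  have dv: "periodic_hol r (deriv v)" "real_symmetric r (deriv v)"
    using periodic_hol_deriv[OF v(1)] real_symmetric_deriv[OF hv v(2)] by auto
  have hdv: "deriv v holomorphic_on band r" using dv by (simp add: periodic_hol_def)
  (* The derivative of z + v z at the rotated point. *)
  define j where "j z = 1 + deriv v (z + of_real \<alpha>)" for z
  have j_lower: "1 / 2 \<le> norm (j z)" and j_upper: "norm (j z) \<le> 3 / 2" and j_re: "1 / 2 \<le> Re (j z)"
    if "z \<in> band r" for z
  proof -
    have *: "norm (deriv v (z + of_real \<alpha>)) \<le> 1 / 2" using vd[of "z + of_real \<alpha>"] that d2 by simp
    show "norm (j z) \<le> 3 / 2" using norm_triangle_ineq[of 1 "deriv v (z + of_real \<alpha>)"] * by (simp add: j_def)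
    show re: "1 / 2 \<le> Re (j z)" using abs_Re_le_cmod[of "deriv v (z + of_real \<alpha>)"] * by (simp add: j_def)
    show "1 / 2 \<le> norm (j z)" using re complex_Re_le_cmod[of "j z"] by linarith
  qed
  have j_ne: "j z \<noteq> 0" if "z \<in> band r" for z using j_lower[OF that] by auto
  have hj: "j holomorphic_on band r"
    unfolding j_def by (intro holomorphic_on_add holomorphic_on_const holomorphic_shift_real hdv)
  define g where "g z = ?e z / j z" for z
  have pg: "periodic_hol r g"
  proof -
    have "?e holomorphic_on band r" using pe by (simp add: periodic_hol_def)
    then have "g holomorphic_on band r" unfolding g_def by (rule holomorphic_on_divide[OF _ hj j_ne])
    moreover have "j (z + 1) = j z" if "z \<in> band r" for z
    proof -
      have "deriv v (z + of_real \<alpha> + 1) = deriv v (z + of_real \<alpha>)" using dv(1) that by (simp add: periodic_hol_def)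
      then show ?thesis by (simp add: j_def add_ac)
    qed
    ultimately show ?thesis using pe by (simp add: periodic_hol_def g_def)
  qed
  have sg: "real_symmetric r g" unfolding real_symmetric_def
  proof
    fix z assume z: "z \<in> band r"
    have "deriv v (cnj (z + of_real \<alpha>)) = cnj (deriv v (z + of_real \<alpha>))"
      using dv(2) z by (simp add: real_symmetric_def del: complex_cnj_add)
    then show "g (cnj z) = cnj (g z)" using se z by (simp add: g_def j_def real_symmetric_def)
  qed
  have gb: "norm (g z) \<le> 2 * \<delta>" if z: "z \<in> band r" for z
  proof -
    have "norm (g z) \<le> \<delta> / (1 / 2)" unfolding g_def norm_divide
      using vE[OF z] j_lower[OF z] \<delta>0 by (intro frac_le) auto
    then show ?thesis by simp
  qed
  have \<sigma>r: "\<sigma> < r" using \<sigma> by simp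
  obtain w c where w: "periodic_hol (r - \<sigma>) w" "real_symmetric (r - \<sigma>) w"
    "\<And>z. z \<in> band (r - \<sigma>) \<Longrightarrow> w (z + of_real \<alpha>) - w z = g z - of_real c"
    "\<And>z. z \<in> band (r - \<sigma>) \<Longrightarrow> norm (w z) \<le> C * (2 * \<delta>) / \<sigma> ^ 4"
    using cohom[OF \<sigma>(1) \<sigma>r pg sg gb] by blast
  have sub1: "band (r - \<sigma>) \<subseteq> band r" and sub2: "band (r - 2 * \<sigma>) \<subseteq> band (r - \<sigma>)"
    using \<sigma> by (auto intro!: band_mono)
  define \<Delta> where "\<Delta> z = (1 + deriv v z) * w z" for z
  have h\<Delta>: "\<Delta> holomorphic_on band (r - \<sigma>)"
  proof -
    have "w holomorphic_on band (r - \<sigma>)" using w(1) by (simp add: periodic_hol_def)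
    then show ?thesis unfolding \<Delta>_def
      by (intro holomorphic_on_mult holomorphic_on_add holomorphic_on_const holomorphic_on_subset[OF hdv sub1])
  qed
  have \<Delta>b: "norm (\<Delta> z) \<le> 3 * C * \<delta> / \<sigma> ^ 4" if z: "z \<in> band (r - \<sigma>)" for z
  proof -
    have "norm (1 + deriv v z) \<le> 3 / 2"
      using norm_triangle_ineq[of 1 "deriv v z"] vd[of z] d2 z sub1 by auto
    then have "norm (\<Delta> z) \<le> 3 / 2 * (C * (2 * \<delta>) / \<sigma> ^ 4)"
      unfolding \<Delta>_def norm_mult using w(4)[OF z] by (intro mult_mono) auto
    then show ?thesis by (simp add: mult_ac)
  qed
  have \<Delta>d: "norm (deriv \<Delta> z) \<le> 3 * C * \<delta> / \<sigma> ^ 5" if z: "z \<in> band (r - 2 * \<sigma>)" for z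
  proof -
    have "norm (deriv \<Delta> z) \<le> 3 * C * \<delta> / \<sigma> ^ 4 / \<sigma>"
      by (rule deriv_bound_band[OF h\<Delta> \<Delta>b \<sigma>(1)]) (use z in auto)
    then show ?thesis by (simp add: field_simps power_Suc2[symmetric] numeral_eq_Suc)
  qed
  define v1 where "v1 z = v z + \<Delta> z" for z
  have p1': "periodic_hol (r - \<sigma>) v1"
  proof -
    have "v1 holomorphic_on band (r - \<sigma>)" unfolding v1_def
      by (intro holomorphic_on_add h\<Delta> holomorphic_on_subset[OF hv sub1])
    moreover have "v1 (z + 1) = v1 z" if "z \<in> band (r - \<sigma>)" for z
      using that sub1 v(1) dv(1) w(1) by (auto simp: v1_def \<Delta>_def periodic_hol_def)
    ultimately show ?thesis by (simp add: periodic_hol_def)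
  qed
  have p1: "periodic_hol (r - 2 * \<sigma>) v1" using periodic_hol_subset[OF p1'] \<sigma> by simp
  have s1: "real_symmetric (r - 2 * \<sigma>) v1" unfolding real_symmetric_def
  proof
    fix z assume "z \<in> band (r - 2 * \<sigma>)"
    then have "z \<in> band (r - \<sigma>)" "z \<in> band r" using sub1 sub2 by auto
    then show "v1 (cnj z) = cnj (v1 z)"
      using v(2) dv(2) w(2) by (simp add: v1_def \<Delta>_def real_symmetric_def)
  qed
  have b1: "norm (v1 z) \<le> \<epsilon> / 8" if z: "z \<in> band (r - \<sigma>)" for z
    using norm_triangle_ineq[of "v z" "\<Delta> z"] vb[of z] \<Delta>b[OF z] z sub1 small_b by (auto simp: v1_def)
  have d1: "norm (deriv v1 z) \<le> d + 3 * C * \<delta> / \<sigma> ^ 5" if z: "z \<in> band (r - 2 * \<sigma>)" for z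
  proof -
    have z': "z \<in> band (r - \<sigma>)" "z \<in> band r" using z sub1 sub2 by auto
    have "(v1 has_field_derivative deriv v z + deriv \<Delta> z) (at z)"
      unfolding v1_def[abs_def]
      by (intro derivative_intros holomorphic_derivI[OF hv open_band z'(2)] holomorphic_derivI[OF h\<Delta> open_band z'(1)])
    then have "deriv v1 z = deriv v z + deriv \<Delta> z" by (rule DERIV_imp_deriv)
    then show ?thesis
      using norm_triangle_ineq[of "deriv v z" "deriv \<Delta> z"] vd[OF z'(2)] \<Delta>d[OF z] by simp
  qed
  (* Sum of the bounds on (derivative of the defect) * w and on the second order Taylor remainder Q. *)
  define R where "R = (2 * C + 9 * C^2 * (64 / \<epsilon>^2)) * \<delta>^2 / \<sigma> ^ 8"
  have main: "norm (conj_error \<alpha> \<eta> v1 z - of_real c * j z) \<le> R" if z: "z \<in> band (r - \<sigma>)" for z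
  proof -
    have zr: "z \<in> band r" and za: "z + of_real \<alpha> \<in> band (r - \<sigma>)" using z sub1 by auto
    define a where "a = z + v z"
    have v1z: "z + v1 z = a + \<Delta> z" by (simp add: a_def v1_def)
    define Q where "Q = \<eta> (a + \<Delta> z) - \<eta> a - deriv \<eta> a * \<Delta> z"
    define e' where "e' = deriv v z - deriv v (z + of_real \<alpha>) + deriv \<eta> a * (1 + deriv v z)"
    have e': "deriv ?e z = e'"
      unfolding e'_def a_def by (rule deriv_conj_error[OF hv vb rb hn zr])
    have weq: "w (z + of_real \<alpha>) = w z + ?e z / j z - of_real c"
      using w(3)[OF z] by (simp add: g_def algebra_simps)
    have j_w: "j z * w (z + of_real \<alpha>) = j z * w z + ?e z - of_real c * j z"
      unfolding weq using j_ne[OF zr] by (simp add: field_simps)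
    have "conj_error \<alpha> \<eta> v1 z = ?e z + \<Delta> z - \<Delta> (z + of_real \<alpha>) + deriv \<eta> a * \<Delta> z + Q"
      unfolding conj_error_def v1z Q_def by (simp add: v1_def a_def)
    also have "\<dots> = ?e z + \<Delta> z - j z * w (z + of_real \<alpha>) + deriv \<eta> a * \<Delta> z + Q"
      by (simp add: \<Delta>_def j_def)
    (* The terms in w collapse by the equation for w and the formula for the derivative of the defect. *)
    also have "\<dots> = e' * w z + of_real c * j z + Q"
      by (subst j_w) (simp add: \<Delta>_def e'_def j_def algebra_simps)
    finally have eq: "conj_error \<alpha> \<eta> v1 z - of_real c * j z = deriv ?e z * w z + Q" by (simp add: e')
    have "?e holomorphic_on band r" using pe by (simp add: periodic_hol_def)
    from deriv_bound_band[OF this vE \<sigma>(1) z] have "norm (deriv ?e z) \<le> \<delta> / \<sigma>" .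
    then have "norm (deriv ?e z * w z) \<le> \<delta> / \<sigma> * (C * (2 * \<delta>) / \<sigma> ^ 4)"
      unfolding norm_mult using w(4)[OF z] \<delta>0 \<sigma> by (intro mult_mono) auto
    also have "\<dots> = 2 * C * \<delta>^2 / \<sigma> ^ 5" by (simp add: field_simps eval_nat_numeral)
    also have "\<dots> \<le> 2 * C * \<delta>^2 / \<sigma> ^ 8" using C by (intro power_le_shorter \<sigma>) auto
    finally have 1: "norm (deriv ?e z * w z) \<le> 2 * C * \<delta>^2 / \<sigma> ^ 8" .
    have a_in: "a \<in> band (\<epsilon> - 2 * (\<epsilon> / 8))"
      unfolding a_def by (rule shift_in_band[OF zr vb[OF zr]]) (use r b8 in simp)
    have a1_in: "a + \<Delta> z \<in> band (\<epsilon> - 2 * (\<epsilon> / 8))"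
      unfolding v1z[symmetric] by (rule shift_in_band[OF zr b1[OF z]]) (use r in simp)
    have "norm Q \<le> 1 / (\<epsilon> / 8)^2 * norm (\<Delta> z)^2"
      using quadratic_taylor_bound[OF hn \<eta>(3) _ a_in a1_in] eps by (simp add: Q_def)
    also have "\<dots> \<le> 1 / (\<epsilon> / 8)^2 * (3 * C * \<delta> / \<sigma> ^ 4)^2"
      using \<Delta>b[OF z] by (intro mult_left_mono power_mono) auto
    also have "\<dots> = 9 * C^2 * (64 / \<epsilon>^2) * \<delta>^2 / \<sigma> ^ 8"
      by (simp add: power_divide power_mult_distrib field_simps flip: power_mult)
    finally have 2: "norm Q \<le> 9 * C^2 * (64 / \<epsilon>^2) * \<delta>^2 / \<sigma> ^ 8" .
    have "R = 2 * C * \<delta>^2 / \<sigma> ^ 8 + 9 * C^2 * (64 / \<epsilon>^2) * \<delta>^2 / \<sigma> ^ 8"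
      by (simp add: R_def distrib_right add_divide_distrib)
    then show ?thesis unfolding eq using norm_triangle_ineq[of "deriv ?e z * w z" Q] 1 2 by linarith
  qed
  have c: "\<bar>c\<bar> \<le> 2 * R"
  proof (rule drift_constant_small[OF nd _ p1 s1])
    show "norm (v1 z) \<le> \<epsilon> / 8" if "z \<in> band (r - 2 * \<sigma>)" for z using b1 that sub2 by auto
    show "norm (deriv v1 z) \<le> 1" if "z \<in> band (r - 2 * \<sigma>)" for z using d1[OF that] small_d by linarith
    show "1 / 2 \<le> Re (j (of_real x))" for x using j_re[of "of_real x"] r0 by (simp add: band_def)
    show "norm (conj_error \<alpha> \<eta> v1 (of_real x) - of_real c * j (of_real x)) \<le> R" for x
      using main[of "of_real x"] \<sigma> by (simp add: band_def)
  qed (use \<sigma> in simp)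
  have R0: "0 \<le> R" using c by linarith
  have E1: "norm (conj_error \<alpha> \<eta> v1 z) \<le> 4 * R" if z: "z \<in> band (r - 2 * \<sigma>)" for z
  proof -
    have z': "z \<in> band (r - \<sigma>)" "z \<in> band r" using z sub1 sub2 by auto
    have "norm (of_real c * j z) \<le> (2 * R) * (3 / 2)"
      unfolding norm_mult using c j_upper[OF z'(2)] by (intro mult_mono) auto
    then show ?thesis
      using norm_triangle_sub[of "conj_error \<alpha> \<eta> v1 z" "of_real c * j z"] main[OF z'(1)] by linarith
  qed
  show thesis
  proof (rule that[OF p1 s1 _ d1])
    show "norm (v1 z - v z) \<le> 3 * C * \<delta> / \<sigma> ^ 4" if "z \<in> band (r - 2 * \<sigma>)" for z
      using \<Delta>b[of z] that sub2 by (auto simp: v1_def)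
    show "norm (conj_error \<alpha> \<eta> v1 z) \<le> 4 * (2 * C + 9 * C^2 * (64 / \<epsilon>^2)) * \<delta>^2 / \<sigma> ^ 8"
      if "z \<in> band (r - 2 * \<sigma>)" for z
    proof -
      have "4 * R = 4 * (2 * C + 9 * C^2 * (64 / \<epsilon>^2)) * \<delta>^2 / \<sigma> ^ 8"
        by (simp only: R_def mult.assoc times_divide_eq_right)
      then show ?thesis using E1[OF that] by (simp only:)
    qed
  qed
qed

section \<open>Convergence of the Newton iteration\<close>

text \<open>With \<open>t = 2 ^ n\<close> the \<open>n\<close>-th step spends \<open>2 s / t \<le> \<epsilon> / (16 t)\<close> of the half-width of the band, where \<open>s\<close> is the
smaller of \<open>\<epsilon> / 32\<close> and \<open>1\<close>, and starts from a defect of at most \<open>\<kappa> / t ^ 9\<close>.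
The exponent \<open>9\<close> exceeds the loss \<open>t ^ 8\<close> of a Newton step: the new defect is of order \<open>t ^ (8 - 18) = t ^ (- 10)\<close>,
and the surplus over \<open>t ^ (- 9)\<close> means that smallness of \<open>\<kappa>\<close> has to be ensured at \<open>n = 0\<close> only. The corrections
of \<open>v\<close> and of its derivative sum to at most \<open>\<epsilon> / 8\<close> and \<open>1 / 2\<close>, which maintains the hypotheses of the next step.\<close>
lemma newton_conjugacy:
  assumes eps: "\<epsilon> > 0"
  shows "\<exists>\<kappa>>0. \<forall>\<alpha> \<eta>. diophantine D \<alpha> \<and> periodic_hol \<epsilon> \<eta> \<and> real_symmetric \<epsilon> \<eta>
      \<and> (\<forall>z\<in>band \<epsilon>. norm (\<eta> z) \<le> \<kappa>) \<and> no_drift \<alpha> \<eta> \<longrightarrow>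
      (\<exists>v. periodic_hol (\<epsilon> / 2) v \<and> (\<forall>z\<in>band (\<epsilon> / 2). norm (v z) \<le> \<epsilon> / 8)
        \<and> (\<forall>x\<in>band (\<epsilon> / 2). \<forall>y\<in>band (\<epsilon> / 2). norm (v x - v y) \<le> norm (x - y) / 2)
        \<and> (\<forall>z\<in>band (\<epsilon> / 2). conj_error \<alpha> \<eta> v z = 0))"
proof -
  obtain C where C: "C \<ge> 1" and cohom:
    "\<And>\<alpha> r \<sigma> g B. \<lbrakk>diophantine D \<alpha>; 0 < \<sigma>; \<sigma> < r; periodic_hol r g; real_symmetric r g; \<And>z. z \<in> band r \<Longrightarrow> norm (g z) \<le> B\<rbrakk> \<Longrightarrow>
      \<exists>w c. periodic_hol (r - \<sigma>) w \<and> real_symmetric (r - \<sigma>) w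
        \<and> (\<forall>z\<in>band (r - \<sigma>). w (z + of_real \<alpha>) - w z = g z - of_real c)
        \<and> (\<forall>z\<in>band (r - \<sigma>). norm (w z) \<le> C * B / \<sigma> ^ 4)"
    using cohomological_equation[of D] by blast
  define A where "A = 4 * (2 * C + 9 * C^2 * (64 / \<epsilon>^2))"
  have A: "A > 0"
    unfolding A_def using C eps by (intro mult_pos_pos add_pos_pos) auto
  define s where "s = min (\<epsilon> / 32) 1"
  have s: "0 < s" "s \<le> 1" "s \<le> \<epsilon> / 32" using eps by (auto simp: s_def)
  (* The entries after 1 serve, in turn, the new defect, the derivative of v, and the size of v. *)
  define \<kappa> where "\<kappa> = Min {1, s ^ 8 / (512 * A), s ^ 5 / (12 * C), s ^ 4 * \<epsilon> / (48 * C)}"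
  have \<kappa>0: "\<kappa> > 0" using s A C eps by (auto simp: \<kappa>_def)
  have \<kappa>1: "\<kappa> \<le> 1" and \<kappa>A: "\<kappa> \<le> s ^ 8 / (512 * A)" and \<kappa>5: "\<kappa> \<le> s ^ 5 / (12 * C)"
    and \<kappa>4: "\<kappa> \<le> s ^ 4 * \<epsilon> / (48 * C)" by (auto simp: \<kappa>_def)
  have main: "\<exists>v. periodic_hol (\<epsilon> / 2) v \<and> (\<forall>z\<in>band (\<epsilon> / 2). norm (v z) \<le> \<epsilon> / 8)
        \<and> (\<forall>x\<in>band (\<epsilon> / 2). \<forall>y\<in>band (\<epsilon> / 2). norm (v x - v y) \<le> norm (x - y) / 2)
        \<and> (\<forall>z\<in>band (\<epsilon> / 2). conj_error \<alpha> \<eta> v z = 0)"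
    if dio: "diophantine D \<alpha>" and \<eta>: "periodic_hol \<epsilon> \<eta>" "real_symmetric \<epsilon> \<eta>"
      and \<eta>b: "\<And>z. z \<in> band \<epsilon> \<Longrightarrow> norm (\<eta> z) \<le> \<kappa>" and nd: "no_drift \<alpha> \<eta>" for \<alpha> \<eta>
  proof -
    have hn: "\<eta> holomorphic_on band \<epsilon>" using \<eta> by (simp add: periodic_hol_def)
    have \<eta>1: "norm (\<eta> z) \<le> 1" if "z \<in> band \<epsilon>" for z using \<eta>b[OF that] \<kappa>1 by simp
    define r where "r n = \<epsilon> / 2 + \<epsilon> / 8 / 2 ^ n" for n :: nat
    define b where "b n = \<epsilon> / 8 * (1 - 1 / 2 ^ n)" for n :: nat
    define d where "d n = 1 / 2 * (1 - 1 / 2 ^ n :: real)" for n :: nat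
    define P where "P n v \<longleftrightarrow> periodic_hol (r n) v \<and> real_symmetric (r n) v \<and>
      (\<forall>z\<in>band (r n). norm (v z) \<le> b n \<and> norm (deriv v z) \<le> d n \<and> norm (conj_error \<alpha> \<eta> v z) \<le> \<kappa> / (2 ^ n) ^ 9)" for n v
    define Q where "Q n v v' \<longleftrightarrow> (\<forall>z\<in>band (\<epsilon> / 2). norm (v' z - v z) \<le> \<epsilon> / 16 * (1 / 2) ^ n)" for n and v v' :: "complex \<Rightarrow> complex"
    have start: "P 0 (\<lambda>_. 0)"
    proof -
      have "band (r 0) \<subseteq> band \<epsilon>" using eps by (intro band_mono) (simp add: r_def)
      then show ?thesis using \<eta>b
        by (auto simp: P_def periodic_hol_def real_symmetric_def b_def d_def conj_error_def subset_iff)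
    qed
    have step: "\<exists>v'. P (Suc n) v' \<and> Q n v v'" if Pv: "P n v" for n v
    proof -
      define t where "t = (2::real) ^ n"
      have t: "t \<ge> 1" by (simp add: t_def)
      define \<sigma> where "\<sigma> = s / t"
      define \<delta> where "\<delta> = \<kappa> / t ^ 9"
      have tm: "t \<le> t ^ m" if "m \<ge> 1" for m using power_increasing[of 1 m t] that t by simp
      have \<sigma>: "0 < \<sigma>" "\<sigma> \<le> 1" "\<sigma> \<le> \<epsilon> / 32 / t"
        using s t by (auto simp: \<sigma>_def divide_le_eq intro!: divide_right_mono)
      have r_n: "r n = \<epsilon> / 2 + \<epsilon> / 8 / t" by (simp add: r_def t_def)
      have r_Suc: "r (Suc n) = \<epsilon> / 2 + \<epsilon> / 16 / t" by (simp add: r_def t_def)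
      have \<sigma>r: "r (Suc n) \<le> r n - 2 * \<sigma>" using \<sigma>(3) by (simp add: r_n r_Suc)
      have "0 < \<epsilon> / 16 / t" using eps t by simp
      then have r_half: "\<epsilon> / 2 < r (Suc n)" by (simp add: r_Suc)
      have r58: "r n \<le> 5 * \<epsilon> / 8" using eps t by (simp add: r_n field_simps)
      have e4: "3 * C * \<delta> / \<sigma> ^ 4 \<le> \<epsilon> / 16 / t"
      proof -
        have "3 * C * \<delta> / \<sigma> ^ 4 = 3 * C * \<kappa> / s ^ 4 / t ^ 5"
          using t s by (simp add: \<delta>_def \<sigma>_def field_simps flip: power_add)
        also have "\<dots> \<le> \<epsilon> / 16 / t"
        proof (rule frac_le)
          show "3 * C * \<kappa> / s ^ 4 \<le> \<epsilon> / 16" using \<kappa>4 s C by (simp add: field_simps)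
        qed (use eps t tm[of 5] in auto)
        finally show ?thesis .
      qed
      have e5: "3 * C * \<delta> / \<sigma> ^ 5 \<le> 1 / 4 / t"
      proof -
        have "3 * C * \<delta> / \<sigma> ^ 5 = 3 * C * \<kappa> / s ^ 5 / t ^ 4"
          using t s by (simp add: \<delta>_def \<sigma>_def field_simps flip: power_add)
        also have "\<dots> \<le> 1 / 4 / t"
        proof (rule frac_le)
          show "3 * C * \<kappa> / s ^ 5 \<le> 1 / 4" using \<kappa>5 s C by (simp add: field_simps)
        qed (use t tm[of 4] in auto)
        finally show ?thesis .
      qed
      have e8: "A * \<delta>^2 / \<sigma> ^ 8 \<le> \<kappa> / (2 ^ Suc n) ^ 9"
      proof -
        have "A * \<delta>^2 / \<sigma> ^ 8 = (512 * A * \<kappa> / s ^ 8) * (\<kappa> / 512) / t ^ 10"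
          using t s by (simp add: \<delta>_def \<sigma>_def field_simps power2_eq_square flip: power_add)
        also have "\<dots> \<le> (\<kappa> / 512) / t ^ 9"
        proof (rule frac_le)
          have "512 * A * \<kappa> / s ^ 8 \<le> 1" using \<kappa>A s A by (simp add: field_simps)
          then have "(512 * A * \<kappa> / s ^ 8) * (\<kappa> / 512) \<le> 1 * (\<kappa> / 512)"
            using \<kappa>0 by (intro mult_right_mono) auto
          then show "(512 * A * \<kappa> / s ^ 8) * (\<kappa> / 512) \<le> \<kappa> / 512" by simp
          show "t ^ 9 \<le> t ^ 10" using t by (intro power_increasing) auto
        qed (use \<kappa>0 t in auto)
        also have "\<dots> = \<kappa> / (2 ^ Suc n) ^ 9" by (simp add: t_def power_mult_distrib)
        finally show ?thesis .
      qed
      have b_Suc: "b (Suc n) = b n + \<epsilon> / 16 / t" by (simp add: b_def t_def field_simps)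
      have d_Suc: "d (Suc n) = d n + 1 / 4 / t" by (simp add: d_def t_def field_simps)
      have b_le: "b (Suc n) \<le> \<epsilon> / 8" using eps by (simp add: b_def mult_le_cancel_left1)
      have d_le: "d (Suc n) \<le> 1 / 2" by (simp add: d_def)
      have v: "periodic_hol (r n) v" "real_symmetric (r n) v"
        and vb: "\<And>z. z \<in> band (r n) \<Longrightarrow> norm (v z) \<le> b n"
        and vd: "\<And>z. z \<in> band (r n) \<Longrightarrow> norm (deriv v z) \<le> d n"
        and vE: "\<And>z. z \<in> band (r n) \<Longrightarrow> norm (conj_error \<alpha> \<eta> v z) \<le> \<delta>"
        using Pv by (auto simp: P_def \<delta>_def t_def)
      obtain v1 where v1: "periodic_hol (r n - 2 * \<sigma>) v1" "real_symmetric (r n - 2 * \<sigma>) v1"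
        and v1b: "\<And>z. z \<in> band (r n - 2 * \<sigma>) \<Longrightarrow> norm (v1 z - v z) \<le> 3 * C * \<delta> / \<sigma> ^ 4"
        and v1d: "\<And>z. z \<in> band (r n - 2 * \<sigma>) \<Longrightarrow> norm (deriv v1 z) \<le> d n + 3 * C * \<delta> / \<sigma> ^ 5"
        and v1E: "\<And>z. z \<in> band (r n - 2 * \<sigma>) \<Longrightarrow> norm (conj_error \<alpha> \<eta> v1 z) \<le> A * \<delta>^2 / \<sigma> ^ 8"
      proof (rule newton_step[OF eps \<eta> \<eta>1 nd C cohom[OF dio] v vb vd vE \<sigma>(1,2) _ r58])
        show "2 * \<sigma> < r n" using \<sigma>r r_half eps by linarith
        show "b n + 3 * C * \<delta> / \<sigma> ^ 4 \<le> \<epsilon> / 8" using e4 b_Suc b_le by linarith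
        show "d n + 3 * C * \<delta> / \<sigma> ^ 5 \<le> 1 / 2" using e5 d_Suc d_le by linarith
      qed (auto simp: A_def)
      have sub: "band (r (Suc n)) \<subseteq> band (r n - 2 * \<sigma>)" "band (r (Suc n)) \<subseteq> band (r n)"
        "band (\<epsilon> / 2) \<subseteq> band (r n - 2 * \<sigma>)"
        using \<sigma>r \<sigma>(1) r_half by (auto intro!: band_mono)
      have close: "norm (v1 z - v z) \<le> \<epsilon> / 16 / t" if "z \<in> band (r n - 2 * \<sigma>)" for z
        using v1b[OF that] e4 by linarith
      have "P (Suc n) v1" unfolding P_def
      proof (intro conjI ballI)
        show "periodic_hol (r (Suc n)) v1" by (rule periodic_hol_subset[OF v1(1) \<sigma>r])
        show "real_symmetric (r (Suc n)) v1" by (rule real_symmetric_subset[OF v1(2) \<sigma>r])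
        fix z assume "z \<in> band (r (Suc n))"
        then have z: "z \<in> band (r n - 2 * \<sigma>)" "z \<in> band (r n)" using sub by auto
        show "norm (v1 z) \<le> b (Suc n)"
          using norm_triangle_sub[of "v1 z" "v z"] vb[OF z(2)] close[OF z(1)] by (simp add: b_Suc)
        show "norm (deriv v1 z) \<le> d (Suc n)" using v1d[OF z(1)] e5 by (simp add: d_Suc)
        show "norm (conj_error \<alpha> \<eta> v1 z) \<le> \<kappa> / (2 ^ Suc n) ^ 9" using v1E[OF z(1)] e8 by linarith
      qed
      moreover have "Q n v v1" unfolding Q_def
      proof
        fix z assume "z \<in> band (\<epsilon> / 2)"
        then have "norm (v1 z - v z) \<le> \<epsilon> / 16 / t" using close sub by auto
        then show "norm (v1 z - v z) \<le> \<epsilon> / 16 * (1 / 2) ^ n" by (simp add: t_def power_divide)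
      qed
      ultimately show ?thesis by blast
    qed
    obtain V where V: "\<And>n. P n (V n)" "\<And>n. Q n (V n) (V (Suc n))"
      using dependent_nat_choice[of P Q] start step by blast
    let ?b = "band (\<epsilon> / 2)"
    have sub: "?b \<subseteq> band (r n)" for n using eps by (intro band_mono) (simp add: r_def)
    have VP: "periodic_hol (r n) (V n)" and Vb: "\<And>z. z \<in> band (r n) \<Longrightarrow> norm (V n z) \<le> b n"
      and Vd: "\<And>z. z \<in> band (r n) \<Longrightarrow> norm (deriv (V n) z) \<le> d n"
      and VE: "\<And>z. z \<in> band (r n) \<Longrightarrow> norm (conj_error \<alpha> \<eta> (V n) z) \<le> \<kappa> / (2 ^ n) ^ 9" for n
      using V(1)[of n] by (auto simp: P_def)
    have Vh: "V n holomorphic_on band (r n)" for n using VP by (simp add: periodic_hol_def)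
    have "summable (\<lambda>n. \<epsilon> / 16 * (1 / 2) ^ n)" by (intro summable_mult summable_geometric) auto
    then have "uniform_limit ?b (\<lambda>n z. \<Sum>i<n. V (Suc i) z - V i z) (\<lambda>z. \<Sum>i. V (Suc i) z - V i z) sequentially"
      by (rule Weierstrass_m_test[rotated]) (use V(2) in \<open>auto simp: Q_def\<close>)
    moreover have "(\<Sum>i<n. V (Suc i) z - V i z) = V n z - V 0 z" for n z
      using sum_lessThan_telescope[of "\<lambda>i. V i z" n] by simp
    ultimately have "uniform_limit ?b (\<lambda>n z. V n z - V 0 z) (\<lambda>z. \<Sum>i. V (Suc i) z - V i z) sequentially"
      by simp
    from uniform_limit_add[OF this uniform_limit_const[where c = "V 0"]]
    obtain v where lim: "uniform_limit ?b V v sequentially" by auto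
    have pt: "(\<lambda>n. V n z) \<longlonglongrightarrow> v z" if "z \<in> ?b" for z by (rule tendsto_uniform_limitI[OF lim that])
    have "v holomorphic_on ?b"
    proof (rule holomorphic_uniform_sequence[OF open_band])
      show "V n holomorphic_on ?b" for n using holomorphic_on_subset[OF Vh sub] .
      fix z assume "z \<in> ?b"
      then obtain e where "e > 0" "cball z e \<subseteq> ?b" using open_contains_cball[of ?b] by auto
      then show "\<exists>d>0. cball z d \<subseteq> ?b \<and> uniform_limit (cball z d) V v sequentially"
        using uniform_limit_on_subset[OF lim] by blast
    qed
    moreover have "v (z + 1) = v z" if z: "z \<in> ?b" for z
    proof -
      have "V n (z + 1) = V n z" for n using VP[of n] z sub[of n] by (auto simp: periodic_hol_def)
      then show ?thesis using pt[of "z + 1"] pt[OF z] z by (simp add: LIMSEQ_unique)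
    qed
    ultimately have "periodic_hol (\<epsilon> / 2) v" by (simp add: periodic_hol_def)
    moreover have vb: "norm (v z) \<le> \<epsilon> / 8" if z: "z \<in> ?b" for z
    proof (rule LIMSEQ_le_const2[OF tendsto_norm[OF pt[OF z]]])
      have "b n \<le> \<epsilon> / 8" for n using eps by (simp add: b_def mult_le_cancel_left1)
      then show "\<exists>N. \<forall>n\<ge>N. norm (V n z) \<le> \<epsilon> / 8" using Vb z sub by (meson order_trans subsetD)
    qed
    moreover have "norm (v x - v y) \<le> norm (x - y) / 2" if xy: "x \<in> ?b" "y \<in> ?b" for x y
    proof (rule LIMSEQ_le_const2[OF tendsto_norm[OF tendsto_diff[OF pt[OF xy(1)] pt[OF xy(2)]]]])
      have "norm (V n x - V n y) \<le> norm (x - y) / 2" for n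
      proof -
        have "norm (V n x - V n y) \<le> d n * norm (x - y)"
          by (rule lipschitz_on_band[OF Vh Vd]) (use xy sub in auto)
        also have "\<dots> \<le> 1 / 2 * norm (x - y)" by (intro mult_right_mono) (auto simp: d_def)
        finally show ?thesis by simp
      qed
      then show "\<exists>N. \<forall>n\<ge>N. norm (V n x - V n y) \<le> norm (x - y) / 2" by blast
    qed
    moreover have "conj_error \<alpha> \<eta> v z = 0" if z: "z \<in> ?b" for z
    proof -
      have "z + v z \<in> band \<epsilon>" by (rule shift_in_band[OF z vb[OF z]]) (use eps in simp)
      then have "isCont \<eta> (z + v z)"
        using hn holomorphic_on_imp_continuous_on continuous_on_eq_continuous_at open_band by blast
      then have "(\<lambda>n. \<eta> (z + V n z)) \<longlonglongrightarrow> \<eta> (z + v z)"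
        by (rule isCont_tendsto_compose) (intro tendsto_intros pt z)
      moreover have "z + of_real \<alpha> \<in> ?b" using z by simp
      ultimately have "(\<lambda>n. conj_error \<alpha> \<eta> (V n) z) \<longlonglongrightarrow> conj_error \<alpha> \<eta> v z"
        unfolding conj_error_def by (intro tendsto_intros pt z)
      moreover have "(\<lambda>n. conj_error \<alpha> \<eta> (V n) z) \<longlonglongrightarrow> 0"
      proof (rule Lim_null_comparison)
        have "norm (conj_error \<alpha> \<eta> (V n) z) \<le> \<kappa> * (1 / 512) ^ n" for n
        proof -
          have "((2::real) ^ n) ^ 9 = 512 ^ n" by (simp add: power_mult[symmetric] mult.commute[of n]) (simp add: power_mult)
          then show ?thesis using VE[of z n] z sub by (auto simp: power_divide)
        qed
        then show "\<forall>\<^sub>F n in sequentially. norm (conj_error \<alpha> \<eta> (V n) z) \<le> \<kappa> * (1 / 512) ^ n" by simp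
        have "(\<lambda>n. \<kappa> * (1 / 512) ^ n) \<longlonglongrightarrow> \<kappa> * 0" by (intro tendsto_intros LIMSEQ_realpow_zero) auto
        then show "(\<lambda>n. \<kappa> * (1 / 512) ^ n) \<longlonglongrightarrow> 0" by simp
      qed
      ultimately show ?thesis by (rule LIMSEQ_unique)
    qed
    ultimately show ?thesis by blast
  qed
  show ?thesis by (rule exI[of _ \<kappa>]) (use \<kappa>0 main in blast)
qed

section \<open>Rotation numbers and the absence of drift\<close>

text \<open>Lifts of monotone circle maps of degree one, that is, the setting of Poincare's rotation number.\<close>
locale degree_one_monotone =
  fixes F :: "real \<Rightarrow> real"
  assumes mono: "mono F" and add_1: "F (x + 1) = F x + 1"
begin

lemma iterate_mono: "mono (F ^^ n)"
  by (induction n) (auto intro!: monoI dest: monoD[OF mono] monoD)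

lemma add_nat: "F (x + real n) = F x + real n"
proof (induction n)
  case (Suc n)
  then show ?case using add_1[of "x + real n"] by (simp add: add_ac)
qed simp

lemma add_int: "F (x + of_int k) = F x + of_int k"
proof (cases "k \<ge> 0")
  case True
  then show ?thesis using add_nat[of x "nat k"] by simp
next
  case False
  then show ?thesis using add_nat[of "x + of_int k" "nat (- k)"] by simp
qed

lemma iterate_add_int: "(F ^^ n) (x + of_int k) = (F ^^ n) x + of_int k"
  by (induction n) (simp_all add: add_int)

lemma iterate_displacement: "\<bar>(F ^^ n) x - x - (F ^^ n) 0\<bar> \<le> 1"
proof -
  let ?k = "\<lfloor>x\<rfloor>"
  have "of_int ?k \<le> x" "x \<le> of_int ?k + 1" by linarith+
  then have "(F ^^ n) (0 + of_int ?k) \<le> (F ^^ n) x" "(F ^^ n) x \<le> (F ^^ n) (0 + of_int (?k + 1))"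
    using monoD[OF iterate_mono] by auto
  then have "(F ^^ n) 0 + of_int ?k \<le> (F ^^ n) x" "(F ^^ n) x \<le> (F ^^ n) 0 + of_int (?k + 1)"
    by (simp_all only: iterate_add_int)
  then show ?thesis by linarith
qed

lemma iterate_multiple: "\<bar>(F ^^ (m * n)) 0 - real m * (F ^^ n) 0\<bar> \<le> real m"
proof (induction m)
  case (Suc m)
  have "(F ^^ (Suc m * n)) 0 = (F ^^ n) ((F ^^ (m * n)) 0)" by (simp add: funpow_add)
  then show ?case
    using Suc iterate_displacement[of n "(F ^^ (m * n)) 0"] by (simp add: distrib_right)
qed simp

text \<open>The displacement of the \<open>n\<close>-th iterate varies by at most \<open>1\<close> over all starting points, hence
\<open>F\<^sup>n 0 / n\<close> and \<open>F\<^sup>m\<^sup>n 0 / (m n)\<close> differ by at most \<open>1 / n\<close>. This gives the limit and the bounded deviation from it.\<close>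
lemma rotation_number_exists:
  obtains \<rho> where "(\<lambda>n. (F ^^ n) 0 / real n) \<longlonglongrightarrow> \<rho>" "\<And>n. \<bar>(F ^^ n) 0 - real n * \<rho>\<bar> \<le> 1"
proof -
  define u where "u n = (F ^^ n) 0 / real n" for n
  have mult: "\<bar>u (m * n) - u n\<bar> \<le> 1 / real n" if "m > 0" "n > 0" for m n
  proof -
    have "u (m * n) - u n = ((F ^^ (m * n)) 0 - real m * (F ^^ n) 0) / (real m * real n)"
      using that by (simp add: u_def field_simps)
    then have "\<bar>u (m * n) - u n\<bar> \<le> real m / (real m * real n)"
      unfolding \<open>u (m * n) - u n = _\<close> abs_divide using iterate_multiple[of m n] that by (intro frac_le) auto
    then show ?thesis using that by simp
  qed
  have close: "\<bar>u m - u n\<bar> \<le> 1 / real m + 1 / real n" if "m > 0" "n > 0" for m n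
    using mult[OF that] mult[OF that(2,1)] by (simp add: mult.commute)
  have "Cauchy u"
  proof (rule metric_CauchyI)
    fix e :: real assume e: "e > 0"
    obtain N where N: "N > 0" "1 / real N < e / 2"
      using e real_arch_inverse[of "e / 2"] by (auto simp: inverse_eq_divide)
    have "dist (u m) (u n) < e" if "m \<ge> N" "n \<ge> N" for m n
    proof -
      have "1 / real m \<le> 1 / real N" "1 / real n \<le> 1 / real N"
        using that N by (auto intro!: divide_left_mono)
      then show ?thesis using close[of m n] that N by (simp add: dist_real_def)
    qed
    then show "\<exists>M. \<forall>m\<ge>M. \<forall>n\<ge>M. dist (u m) (u n) < e" by blast
  qed
  then obtain \<rho> where \<rho>: "u \<longlonglongrightarrow> \<rho>" by (auto simp: Cauchy_convergent_iff convergent_def)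
  have "\<bar>(F ^^ n) 0 - real n * \<rho>\<bar> \<le> 1" for n
  proof (cases "n = 0")
    case False
    have "(\<lambda>m. 1 / real m + 1 / real n) \<longlonglongrightarrow> 0 + 1 / real n"
      by (intro tendsto_intros lim_1_over_n)
    moreover have "(\<lambda>m. \<bar>u m - u n\<bar>) \<longlonglongrightarrow> \<bar>\<rho> - u n\<bar>" by (intro tendsto_intros \<rho>)
    moreover have "\<exists>N. \<forall>m\<ge>N. \<bar>u m - u n\<bar> \<le> 1 / real m + 1 / real n"
      using close False by (intro exI[of _ 1]) auto
    ultimately have "\<bar>\<rho> - u n\<bar> \<le> 0 + 1 / real n" by (blast intro: LIMSEQ_le)
    then have "real n * \<bar>\<rho> - u n\<bar> \<le> real n * (1 / real n)" by (intro mult_left_mono) auto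
    moreover have "real n * \<bar>\<rho> - u n\<bar> = \<bar>(F ^^ n) 0 - real n * \<rho>\<bar>"
    proof -
      have "(F ^^ n) 0 - real n * \<rho> = - (real n * (\<rho> - u n))" using False by (simp add: u_def field_simps)
      then show ?thesis by (simp add: abs_mult)
    qed
    ultimately show ?thesis using False by simp
  qed simp
  then show thesis using that[OF \<rho>[unfolded u_def[abs_def]]] by blast
qed

text \<open>Suppose not, and let \<open>\<xi> x = x + v x\<close>. As \<open>\<xi>\<close> is Lipschitz with constant \<open>2\<close>, the gain \<open>\<mu>\<close>
in the image means a gain of \<open>\<mu> / 2\<close> in the argument, so \<open>F\<^sup>n (\<xi> 0) \<ge> \<xi> (n (\<alpha> + \<mu> / 2))\<close>, which
forces a rotation number of at least \<open>\<alpha> + \<mu> / 2\<close>.\<close>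
lemma no_positive_drift:
  assumes rot: "\<And>n. \<bar>(F ^^ n) 0 - real n * \<alpha>\<bar> \<le> 1"
    and lip: "\<And>x y. \<bar>v x - v y\<bar> \<le> \<bar>x - y\<bar>" and bdd: "bounded (range v)" and \<mu>: "\<mu> > 0"
  shows "\<exists>x. F (x + v x) < x + \<alpha> + v (x + \<alpha>) + \<mu>"
proof (rule ccontr)
  assume "\<not> ?thesis"
  then have drift: "x + \<alpha> + v (x + \<alpha>) + \<mu> \<le> F (x + v x)" for x by (simp add: not_less)
  define \<beta> where "\<beta> = \<alpha> + \<mu> / 2"
  have iter: "real n * \<beta> + v (real n * \<beta>) \<le> (F ^^ n) (v 0)" for n
  proof (induction n)
    case (Suc n)
    let ?x = "real n * \<beta>"
    have x: "real (Suc n) * \<beta> = ?x + \<beta>" by (simp add: algebra_simps)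
    have "\<beta> = \<alpha> + \<mu> / 2" "\<bar>(?x + \<beta>) - (?x + \<alpha>)\<bar> = \<mu> / 2" using \<mu> by (simp_all add: \<beta>_def)
    then have "(?x + \<beta>) + v (?x + \<beta>) \<le> ?x + \<alpha> + v (?x + \<alpha>) + \<mu>"
      using lip[of "?x + \<beta>" "?x + \<alpha>"] by linarith
    also have "\<dots> \<le> F (?x + v ?x)" by (rule drift)
    also have "\<dots> \<le> F ((F ^^ n) (v 0))" using monoD[OF mono Suc] .
    finally show ?case unfolding x by simp
  qed simp
  obtain B where B: "\<And>x. \<bar>v x\<bar> \<le> B" using bdd by (auto simp: bounded_iff)
  have bound: "real n * (\<mu> / 2) \<le> 2 * B + 2" for n
  proof -
    have "real n * \<alpha> + real n * (\<mu> / 2) + v (real n * \<beta>) \<le> (F ^^ n) (v 0)"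
      using iter[of n] by (simp add: \<beta>_def distrib_left)
    then show ?thesis
      using iterate_displacement[of n "v 0"] rot[of n] B[of 0] B[of "real n * \<beta>"] by linarith
  qed
  have "\<forall>y. \<exists>n. y < real n * (\<mu> / 2)" by (rule reals_Archimedean3) (use \<mu> in simp)
  then obtain n where "2 * B + 2 < real n * (\<mu> / 2)" by blast
  then show False using bound[of n] by simp
qed

end

text \<open>Drift in the negative direction is excluded by applying the positive case to the reflected map \<open>- F (- x)\<close>.\<close>
lemma no_drift_of_rotation_number:
  assumes F: "degree_one_monotone (\<lambda>x. x + \<alpha> + Re (\<eta> (of_real x)))"
    and rot: "\<And>n. \<bar>((\<lambda>x. x + \<alpha> + Re (\<eta> (of_real x))) ^^ n) 0 - real n * \<alpha>\<bar> \<le> 1"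
  shows "no_drift \<alpha> \<eta>"
  unfolding no_drift_def
proof (intro allI impI conjI)
  fix v :: "real \<Rightarrow> real" and \<mu> :: real
  assume \<mu>: "\<mu> > 0" and lip: "\<forall>x y. \<bar>v x - v y\<bar> \<le> \<bar>x - y\<bar>" and bdd: "bounded (range v)"
  let ?F = "\<lambda>x. x + \<alpha> + Re (\<eta> (of_real x))"
  interpret F: degree_one_monotone ?F by (rule F)
  show "\<exists>x. v x - v (x + \<alpha>) + Re (\<eta> (of_real (x + v x))) < \<mu>"
  proof -
    obtain x where "?F (x + v x) < x + \<alpha> + v (x + \<alpha>) + \<mu>"
      using F.no_positive_drift[of \<alpha> v \<mu>] rot lip bdd \<mu> by blast
    then have "v x - v (x + \<alpha>) + Re (\<eta> (of_real (x + v x))) < \<mu>" by linarith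
    then show ?thesis by blast
  qed
  define G where "G x = - ?F (- x)" for x
  have "degree_one_monotone G"
  proof
    show "mono G" unfolding G_def using monoD[OF F.mono] by (intro monoI) (metis neg_le_iff_le)
    show "G (x + 1) = G x + 1" for x using F.add_1[of "- x - 1"] by (simp add: G_def)
  qed
  then interpret G: degree_one_monotone G .
  have iter: "(G ^^ n) x = - (?F ^^ n) (- x)" for n x
    by (induction n) (simp_all add: G_def)
  show "\<exists>x. - \<mu> < v x - v (x + \<alpha>) + Re (\<eta> (of_real (x + v x)))"
  proof -
    have "\<bar>(G ^^ n) 0 - real n * (- \<alpha>)\<bar> \<le> 1" for n using rot[of n] by (simp add: iter)
    moreover have "\<bar>(- v (- x)) - (- v (- y))\<bar> \<le> \<bar>x - y\<bar>" for x y
      using lip[rule_format, of "- y" "- x"] by simp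
    moreover have "bounded (range (\<lambda>x. - v (- x)))" using bdd by (auto simp: bounded_iff)
    ultimately obtain x where "G (x + - v (- x)) < x + - \<alpha> + - v (- (x + - \<alpha>)) + \<mu>"
      using G.no_positive_drift[of "- \<alpha>" "\<lambda>x. - v (- x)" \<mu>] \<mu> by blast
    then have "- \<mu> < v (- x) - v (- x + \<alpha>) + Re (\<eta> (of_real (- x + v (- x))))"
      by (simp add: G_def)
    then show ?thesis by blast
  qed
qed

section \<open>From the cylinder to lifts and back\<close>

lemma proj_in_strip_iff: "proj z \<in> strip r \<longleftrightarrow> z \<in> band r"
  by (simp add: strip_def band_def cIm_proj)

lemma proj_in_circle_iff: "proj z \<in> circle \<longleftrightarrow> Im z = 0"
  by (simp add: circle_def cIm_proj)

lemma Ints_norm_less_1: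
  assumes "z \<in> \<int>" "norm z < 1"
  shows "z = (0 :: 'a :: real_normed_algebra_1)"
proof -
  obtain n where n: "z = of_int n" using assms(1) by (auto simp: Ints_def)
  then have "\<bar>n\<bar> < 1" using assms(2) by simp
  then show ?thesis using n by simp
qed

lemma bounded_strip: "bounded (strip r)"
proof -
  have "dist (proj 0) p \<le> 1 + r" if "p \<in> strip r" for p
  proof -
    obtain z where z: "p = proj z" by (rule proj_cases)
    define w where "w = z - of_int \<lfloor>Re z\<rfloor>"
    have "p = proj w" by (simp add: z w_def proj_eq_iff)
    moreover have "norm w \<le> 1 + r"
    proof -
      have "\<bar>Im w\<bar> \<le> r" using that by (simp add: z w_def proj_in_strip_iff band_def)
      moreover have "\<bar>Re w\<bar> \<le> 1" by (simp add: w_def) linarith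
      ultimately show ?thesis using cmod_le[of w] by linarith
    qed
    ultimately show ?thesis using dist_proj_le[of 0 w] by simp
  qed
  then show ?thesis by (auto simp: bounded_def)
qed

lemma dist_less_of_sup_dist:
  assumes f: "f \<in> D_space \<epsilon>" and \<kappa>: "sup_dist \<epsilon> f (rot \<alpha>) < \<kappa>" and p: "p \<in> strip \<epsilon>"
  shows "dist (f p) (rot \<alpha> p) < \<kappa>"
proof -
  have rot: "rot \<alpha> q \<in> strip \<epsilon>" if "q \<in> strip \<epsilon>" for q
  proof -
    obtain z where "q = proj z" by (rule proj_cases)
    then show ?thesis using that by (simp add: rot_proj proj_in_strip_iff)
  qed
  have "bounded (f ` strip \<epsilon> \<union> strip \<epsilon>)" using f bounded_strip by (simp add: D_space_def)
  then obtain e where e: "\<And>q. q \<in> f ` strip \<epsilon> \<union> strip \<epsilon> \<Longrightarrow> dist (proj 0) q \<le> e"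
    using bounded_any_center by metis
  have "dist (f q) (rot \<alpha> q) \<le> 2 * e" if "q \<in> strip \<epsilon>" for q
    using e[of "f q"] e[of "rot \<alpha> q"] dist_triangle3[of "f q" "rot \<alpha> q" "proj 0"] rot[OF that] that by auto
  then have "bdd_above ((\<lambda>q. dist (f q) (rot \<alpha> q)) ` strip \<epsilon>)" by (auto simp: bdd_above_def)
  then have "dist (f p) (rot \<alpha> p) \<le> sup_dist \<epsilon> f (rot \<alpha>)"
    unfolding sup_dist_def using p by (rule cSUP_upper[rotated])
  then show ?thesis using \<kappa> by simp
qed

lemma small_representative_unique:
  assumes "proj (z + u) = proj (z + u')" "norm u < 1 / 2" "norm u' \<le> 1 / 2"
  shows "u = u'"
proof -
  have "(z + u) - (z + u') \<in> \<int>" using assms(1) by (simp only: proj_eq_iff)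
  then have int: "u - u' \<in> \<int>" by simp
  moreover have "norm (u - u') < 1" using norm_triangle_ineq4[of u u'] assms by linarith
  ultimately show ?thesis using Ints_norm_less_1[of "u - u'"] by simp
qed

text \<open>The small lift \<open>\<eta>\<close> of \<open>f - R\<^sub>\<alpha>\<close> is unique because its values have modulus below \<open>1/4\<close>; uniqueness gives periodicity,
and also holomorphy, as \<open>\<eta>\<close> has to agree locally with the given holomorphic representatives of \<open>f\<close> up to
an integer. That \<open>f\<close> preserves the circle makes \<open>\<eta>\<close> real on the real axis, which extends to the band as a
reflection symmetry.\<close>
lemma lift_near_rotation:
  assumes hol: "cyl_holomorphic_on f (strip \<epsilon>)" and circ: "f ` circle \<subseteq> circle" and eps: "\<epsilon> > 0"
    and \<kappa>: "\<kappa> \<le> 1 / 4" and close: "\<And>p. p \<in> strip \<epsilon> \<Longrightarrow> dist (f p) (rot \<alpha> p) < \<kappa>"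
  obtains \<eta> where "periodic_hol \<epsilon> \<eta>" "real_symmetric \<epsilon> \<eta>"
    "\<And>z. z \<in> band \<epsilon> \<Longrightarrow> norm (\<eta> z) < \<kappa>"
    "\<And>z. z \<in> band \<epsilon> \<Longrightarrow> f (proj z) = proj (z + of_real \<alpha> + \<eta> z)"
proof -
  have ex: "\<exists>u. norm u < \<kappa> \<and> f (proj z) = proj (z + of_real \<alpha> + u)" if z: "z \<in> band \<epsilon>" for z
  proof -
    obtain y where y: "f (proj z) = proj y" by (rule proj_cases)
    obtain y' where y': "proj y' = proj y" "dist (proj (z + of_real \<alpha>)) (proj y) = dist (z + of_real \<alpha>) y'"
      by (rule dist_proj_attained)
    have "dist (z + of_real \<alpha>) y' < \<kappa>"
      using close[of "proj z"] z y y' by (simp add: proj_in_strip_iff rot_proj dist_commute)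
    then show ?thesis
      using y y'(1) by (intro exI[of _ "y' - (z + of_real \<alpha>)"]) (simp add: dist_norm norm_minus_commute)
  qed
  define \<eta> where "\<eta> z = (SOME u. norm u < \<kappa> \<and> f (proj z) = proj (z + of_real \<alpha> + u))" for z
  have \<eta>: "norm (\<eta> z) < \<kappa>" "f (proj z) = proj (z + of_real \<alpha> + \<eta> z)" if "z \<in> band \<epsilon>" for z
    using someI_ex[OF ex[OF that]] unfolding \<eta>_def by auto
  have unique: "\<eta> z = u" if "z \<in> band \<epsilon>" "f (proj z) = proj (z + of_real \<alpha> + u)" "norm u \<le> 1 / 2" for z u
    by (rule small_representative_unique[of "z + of_real \<alpha>"]) (use \<eta>[OF that(1)] that \<kappa> in auto)
  have "\<eta> field_differentiable at z" if z: "z \<in> band \<epsilon>" for z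
  proof -
    have "proj z \<in> strip \<epsilon>" using z by (simp add: proj_in_strip_iff)
    then obtain e g where e: "e > 0" "g holomorphic_on ball z e" "\<And>w. w \<in> ball z e \<Longrightarrow> f (proj w) = proj (g w)"
      using hol unfolding cyl_holomorphic_on_def by blast
    define m where "m = g z - (z + of_real \<alpha> + \<eta> z)"
    have "proj (g z) = proj (z + of_real \<alpha> + \<eta> z)" using e(1) e(3)[of z] \<eta>(2)[OF z] by simp
    then have m: "m \<in> \<int>" by (simp add: m_def proj_eq_iff)
    define u where "u w = g w - w - of_real \<alpha> - m" for w
    have hu: "u holomorphic_on ball z e" unfolding u_def by (intro holomorphic_intros e(2))
    define U where "U = band \<epsilon> \<inter> (ball z e \<inter> u -` ball 0 (1 / 2))"
    have oU: "open U" unfolding U_def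
      by (intro open_Int open_band continuous_open_preimage open_ball holomorphic_on_imp_continuous_on hu)
    have "u z = \<eta> z" by (simp add: u_def m_def)
    then have zU: "z \<in> U" using z e(1) \<eta>(1)[OF z] \<kappa> by (simp add: U_def)
    have "u holomorphic_on U" by (rule holomorphic_on_subset[OF hu]) (auto simp: U_def)
    then have "\<eta> holomorphic_on U"
    proof (rule holomorphic_transform)
      fix w assume w: "w \<in> U"
      have "f (proj w) = proj (g w)" using e(3) w by (simp add: U_def)
      also have "\<dots> = proj (w + of_real \<alpha> + u w)" using m by (simp add: u_def proj_eq_iff)
      finally show "u w = \<eta> w" using unique[of w "u w"] w by (simp add: U_def)
    qed
    then show ?thesis using holomorphic_on_imp_differentiable_at oU zU by blast
  qed
  then have h\<eta>: "\<eta> holomorphic_on band \<epsilon>"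
    by (auto simp: holomorphic_on_def intro: field_differentiable_at_within)
  have per: "\<eta> (z + 1) = \<eta> z" if z: "z \<in> band \<epsilon>" for z
  proof (rule unique)
    have "proj (z + 1) = proj z" by (simp add: proj_eq_iff)
    then have "f (proj (z + 1)) = proj (z + of_real \<alpha> + \<eta> z)" using \<eta>(2)[OF z] by simp
    also have "\<dots> = proj (z + 1 + of_real \<alpha> + \<eta> z)" by (simp add: proj_eq_iff)
    finally show "f (proj (z + 1)) = proj (z + 1 + of_real \<alpha> + \<eta> z)" .
  qed (use z \<eta>(1)[OF z] \<kappa> in auto)
  have real: "Im (\<eta> (of_real x)) = 0" for x
  proof -
    have x: "complex_of_real x \<in> band \<epsilon>" using eps by (simp add: band_def)
    have "f (proj (of_real x)) \<in> circle" using circ by (auto simp: proj_in_circle_iff)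
    then show ?thesis by (simp add: \<eta>(2)[OF x] proj_in_circle_iff)
  qed
  have sym: "\<eta> z - cnj (\<eta> (cnj z)) = 0" if z: "z \<in> band \<epsilon>" for z
  proof (rule analytic_continuation[where S = "band \<epsilon>" and U = "\<real>" and \<xi> = 0 and f = "\<lambda>z. \<eta> z - cnj (\<eta> (cnj z))"])
    show "(\<lambda>z. \<eta> z - cnj (\<eta> (cnj z))) holomorphic_on band \<epsilon>"
      by (intro holomorphic_on_diff h\<eta> holomorphic_cnj_cnj_band)
    show "\<real> \<subseteq> band \<epsilon>" using eps by (auto simp: band_def Reals_def)
    show "0 islimpt (\<real> :: complex set)"
      unfolding islimpt_approachable
    proof (intro allI impI)
      fix e :: real assume "e > 0"
      then show "\<exists>x'\<in>\<real>. x' \<noteq> 0 \<and> dist x' (0::complex) < e"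
        by (intro bexI[of _ "of_real (e / 2)"]) auto
    qed
    show "\<eta> z - cnj (\<eta> (cnj z)) = 0" if "z \<in> \<real>" for z
      using that real by (auto simp: Reals_def complex_eq_iff)
  qed (use z eps in \<open>auto simp: band_iff\<close>)
  have "real_symmetric \<epsilon> \<eta>" unfolding real_symmetric_def
  proof
    fix z assume "z \<in> band \<epsilon>"
    then show "\<eta> (cnj z) = cnj (\<eta> z)" using sym[of "cnj z"] by simp
  qed
  then show thesis using that[of \<eta>] h\<eta> per \<eta> by (simp add: periodic_hol_def)
qed

lemma circle_lifts_differ_by_int:
  assumes F: "circle_lift f F" and G: "circle_lift f G"
  obtains m :: int where "\<And>x. G x = F x + of_int m"
proof -
  have int: "G x - F x \<in> \<int>" for x
  proof -
    have "proj (of_real (G x)) = proj (of_real (F x))" using F G by (simp add: circle_lift_def flip: complex_of_real_def)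
    then have "of_real (G x - F x) \<in> (\<int> :: complex set)" by (simp add: proj_eq_iff)
    then show ?thesis by (auto simp: complex_is_Int_iff)
  qed
  have "(\<lambda>x. G x - F x) constant_on UNIV"
  proof (rule continuous_discrete_range_constant[OF connected_UNIV])
    show "continuous_on UNIV (\<lambda>x. G x - F x)" using F G by (auto simp: circle_lift_def intro!: continuous_intros)
    fix x
    show "\<exists>e>0. \<forall>y. y \<in> UNIV \<and> G y - F y \<noteq> G x - F x \<longrightarrow> e \<le> norm ((G y - F y) - (G x - F x))"
    proof (intro exI[of _ 1] conjI allI impI)
      fix y assume "y \<in> UNIV \<and> G y - F y \<noteq> G x - F x"
      then show "1 \<le> norm ((G y - F y) - (G x - F x))"
        using Ints_norm_less_1[OF Ints_diff[OF int int], of y x] by (meson eq_iff_diff_eq_0 not_le)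
    qed simp
  qed
  then obtain c where c: "\<And>x. G x - F x = c" by (auto simp: constant_on_def)
  then obtain m where "c = of_int m" using int[of 0] by (auto simp: Ints_def)
  then show thesis using c that[of m] by (metis add.commute diff_add_cancel)
qed

text \<open>The rotation number of the chosen lift agrees with \<open>\<alpha>\<close> modulo integers; as the displacement of \<open>F\<close> is within
\<open>1/4\<close> of \<open>\<alpha>\<close>, that of \<open>F\<close> itself is exactly \<open>\<alpha>\<close>.\<close>
lemma rotation_number_of_lift:
  assumes F: "degree_one_monotone F" and lift: "circle_lift f F"
    and near: "\<And>x. \<bar>F x - x - \<alpha>\<bar> \<le> 1 / 4" and \<alpha>: "\<alpha> = rotation_number f"
  shows "\<bar>(F ^^ n) 0 - real n * \<alpha>\<bar> \<le> 1"
proof -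
  interpret degree_one_monotone F by (rule F)
  obtain \<rho> where \<rho>: "(\<lambda>n. (F ^^ n) 0 / real n) \<longlonglongrightarrow> \<rho>" "\<And>n. \<bar>(F ^^ n) 0 - real n * \<rho>\<bar> \<le> 1"
    using rotation_number_exists by blast
  define G where "G = (SOME F. circle_lift f F)"
  have "circle_lift f G" unfolding G_def by (rule someI[of "circle_lift f", OF lift])
  from circle_lifts_differ_by_int[OF lift this] obtain m where m: "\<And>x. G x = F x + of_int m" by blast
  have iter: "(G ^^ n) 0 = (F ^^ n) 0 + of_int (int n * m)" for n
  proof (induction n)
    case (Suc n)
    (* The arbitrary lift G chosen by the definition of the rotation number is F plus the integer m. *)
    have "(G ^^ Suc n) 0 = F ((F ^^ n) 0 + of_int (int n * m)) + of_int m" by (simp add: Suc m)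
    then show ?case unfolding add_int by (simp add: algebra_simps)
  qed simp
  have "(\<lambda>n. (F ^^ n) 0 / real n + of_int m) \<longlonglongrightarrow> \<rho> + of_int m" by (intro tendsto_intros \<rho>)
  then have "(\<lambda>n. (G ^^ n) 0 / real n) \<longlonglongrightarrow> \<rho> + of_int m"
  proof (rule Lim_transform_eventually)
    have "(F ^^ n) 0 / real n + of_int m = (G ^^ n) 0 / real n" if "n > 0" for n
      using that by (simp add: iter field_simps)
    then show "\<forall>\<^sub>F n in sequentially. (F ^^ n) 0 / real n + of_int m = (G ^^ n) 0 / real n"
      by (rule eventually_mono[OF eventually_gt_at_top[of 0]])
  qed
  then have "lim (\<lambda>n. (G ^^ n) 0 / real n) = \<rho> + of_int m" by (rule limI)
  then have "\<alpha> = frac (\<rho> + of_int m)" by (simp add: \<alpha> rotation_number_def G_def)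
  then have "\<rho> - \<alpha> = - of_int m + of_int \<lfloor>\<rho> + of_int m\<rfloor>" by (simp add: frac_def)
  then have "\<rho> - \<alpha> \<in> \<int>" by simp
  moreover have "\<bar>\<rho> - \<alpha>\<bar> < 1"
  proof -
    have "\<bar>(F ^^ k) 0 - real k * \<alpha>\<bar> \<le> real k / 4" for k
    proof (induction k)
      case (Suc k)
      have "(F ^^ Suc k) 0 = F ((F ^^ k) 0)" "real (Suc k) * \<alpha> = real k * \<alpha> + \<alpha>" "real (Suc k) / 4 = real k / 4 + 1 / 4"
        by (simp_all add: distrib_right add_divide_distrib)
      then show ?case using Suc near[of "(F ^^ k) 0"] by linarith
    qed simp
    (* Four iterates suffice: 4 times the difference is at most 1 + 4 / 4. *)
    from this[of 4] \<rho>(2)[of 4] show ?thesis by simp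
  qed
  ultimately have "\<rho> = \<alpha>" using Ints_norm_less_1[of "\<rho> - \<alpha>"] by simp
  then show ?thesis using \<rho>(2) by simp
qed

text \<open>The Cauchy estimate bounds the derivative of \<open>\<eta>\<close> on the real axis by \<open>1\<close>, which makes the real lift monotone.\<close>
lemma no_drift_near_rotation:
  assumes eps: "\<epsilon> > 0" and \<eta>: "periodic_hol \<epsilon> \<eta>" "real_symmetric \<epsilon> \<eta>"
    and \<eta>b: "\<And>z. z \<in> band \<epsilon> \<Longrightarrow> norm (\<eta> z) < \<kappa>" and \<kappa>: "\<kappa> \<le> 1 / 4" "\<kappa> \<le> \<epsilon> / 2"
    and f: "\<And>z. z \<in> band \<epsilon> \<Longrightarrow> f (proj z) = proj (z + of_real \<alpha> + \<eta> z)"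
    and \<alpha>: "\<alpha> = rotation_number f"
  shows "no_drift \<alpha> \<eta>"
proof -
  let ?F = "\<lambda>x. x + \<alpha> + Re (\<eta> (of_real x))"
  have h: "\<eta> holomorphic_on band \<epsilon>" using \<eta> by (simp add: periodic_hol_def)
  have in_band: "complex_of_real x \<in> band \<epsilon>" "complex_of_real x \<in> band (\<epsilon> / 2)" for x
    using eps by (auto simp: band_def)
  have re: "\<eta> (of_real x) = of_real (Re (\<eta> (of_real x)))" for x
    by (rule real_symmetric_of_real[OF \<eta>(2) eps])
  have "norm (deriv \<eta> z) \<le> 1" if "z \<in> band (\<epsilon> / 2)" for z
  proof -
    have "norm (deriv \<eta> z) \<le> \<kappa> / (\<epsilon> / 2)"
      by (rule deriv_bound_band[OF h less_imp_le[OF \<eta>b]]) (use eps that in \<open>auto simp: field_simps\<close>)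
    also have "\<dots> \<le> 1" using \<kappa> eps by (simp add: divide_le_eq)
    finally show ?thesis .
  qed
  then have lip: "norm (\<eta> (of_real x) - \<eta> (of_real y)) \<le> 1 * norm (complex_of_real x - of_real y)" for x y
    by (intro lipschitz_on_band[of \<eta> "\<epsilon> / 2"] in_band holomorphic_on_subset[OF h] band_mono) (use eps in auto)
  have dom: "degree_one_monotone ?F"
  proof
    show "mono ?F"
    proof (rule monoI)
      fix x y :: real assume "x \<le> y"
      then have "\<bar>Re (\<eta> (of_real x)) - Re (\<eta> (of_real y))\<bar> \<le> y - x"
        using lip[of x y] abs_Re_le_cmod[of "\<eta> (of_real x) - \<eta> (of_real y)"] by (simp flip: of_real_diff)
      then show "?F x \<le> ?F y" by linarith
    qed
    show "?F (x + 1) = ?F x + 1" for x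
      using \<eta>(1) in_band[of x] by (simp add: periodic_hol_def)
  qed
  have "continuous_on UNIV (\<lambda>x. \<eta> (of_real x))"
    by (rule continuous_on_compose2[OF holomorphic_on_imp_continuous_on[OF h]])
      (use in_band in \<open>auto intro!: continuous_intros\<close>)
  then have "continuous_on UNIV ?F" by (intro continuous_intros)
  moreover have "f (proj (of_real x)) = proj (of_real (?F x))" for x
    using f[OF in_band(1), of x] re[of x] by simp
  ultimately have lift: "circle_lift f ?F" by (simp add: circle_lift_def)
  have near: "\<bar>?F x - x - \<alpha>\<bar> \<le> 1 / 4" for x
    using abs_Re_le_cmod[of "\<eta> (of_real x)"] \<eta>b[OF in_band(1), of x] \<kappa> by simp
  show ?thesis
    by (rule no_drift_of_rotation_number[OF dom rotation_number_of_lift[OF dom lift near \<alpha>]])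
qed

text \<open>Injectivity on the cylinder: if \<open>\<xi> z\<close> and \<open>\<xi> w\<close> differ by an integer \<open>n\<close>, then \<open>\<xi> z = \<xi> (w + n)\<close> by periodicity, and
\<open>z = w + n\<close> because \<open>v\<close> is a contraction.\<close>
lemma conjugacy_descends:
  assumes eps: "\<epsilon> > 0" and v: "periodic_hol (\<epsilon> / 2) v"
    and vb: "\<And>z. z \<in> band (\<epsilon> / 2) \<Longrightarrow> norm (v z) \<le> \<epsilon> / 8"
    and lip: "\<And>x y. x \<in> band (\<epsilon> / 2) \<Longrightarrow> y \<in> band (\<epsilon> / 2) \<Longrightarrow> norm (v x - v y) \<le> norm (x - y) / 2"
    and conj: "\<And>z. z \<in> band (\<epsilon> / 2) \<Longrightarrow> conj_error \<alpha> \<eta> v z = 0"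
    and f: "\<And>z. z \<in> band \<epsilon> \<Longrightarrow> f (proj z) = proj (z + of_real \<alpha> + \<eta> z)"
  shows "conformally_conjugate_to_rot \<epsilon> f \<alpha>"
proof -
  define X where "X p = (let z = SOME z. proj z = p in proj (z + v z))" for p
  have shift: "v (z + n) = v z" if "z \<in> band (\<epsilon> / 2)" "n \<in> \<int>" for z n
    using periodic_hol_int_shift[OF v that(1), of "z + n"] that(2) by simp
  have X: "X (proj z) = proj (z + v z)" if z: "z \<in> band (\<epsilon> / 2)" for z
  proof -
    define w where "w = (SOME w. proj w = proj z)"
    have "proj w = proj z" unfolding w_def by (rule someI) simp
    then have int: "w - z \<in> \<int>" by (simp add: proj_eq_iff)
    then have "v w = v z" using shift[OF z int] by simp
    then show ?thesis using int unfolding X_def Let_def w_def[symmetric] by (simp add: proj_eq_iff)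
  qed
  have in_band: "z + v z \<in> band \<epsilon>" if "z \<in> band (\<epsilon> / 2)" for z
    by (rule shift_in_band[OF that vb[OF that]]) (use eps in simp)
  have "cyl_holomorphic_on X (strip (\<epsilon> / 2))"
    unfolding cyl_holomorphic_on_def
  proof (intro allI impI)
    fix z assume "proj z \<in> strip (\<epsilon> / 2)"
    then have "z \<in> band (\<epsilon> / 2)" by (simp add: proj_in_strip_iff)
    then obtain e where e: "e > 0" "ball z e \<subseteq> band (\<epsilon> / 2)" using open_contains_ball[of "band (\<epsilon> / 2)"] by auto
    have "v holomorphic_on band (\<epsilon> / 2)" using v by (simp add: periodic_hol_def)
    then have "(\<lambda>w. w + v w) holomorphic_on ball z e"
      by (intro holomorphic_intros holomorphic_on_subset[OF _ e(2)])
    then show "\<exists>e>0. \<exists>g. g holomorphic_on ball z e \<and> (\<forall>w\<in>ball z e. X (proj w) = proj (g w))"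
      using e X by blast
  qed
  moreover have "inj_on X (strip (\<epsilon> / 2))"
  proof (rule inj_onI)
    fix p q assume pq: "p \<in> strip (\<epsilon> / 2)" "q \<in> strip (\<epsilon> / 2)" "X p = X q"
    obtain z w where zw: "p = proj z" "q = proj w" by (metis proj_cases)
    have z: "z \<in> band (\<epsilon> / 2)" and w: "w \<in> band (\<epsilon> / 2)" using pq zw by (simp_all add: proj_in_strip_iff)
    define n where "n = z + v z - (w + v w)"
    have n: "n \<in> \<int>" using pq(3) X[OF z] X[OF w] zw by (simp add: n_def proj_eq_iff)
    then obtain k where k: "n = of_int k" by (auto simp: Ints_def)
    have wn: "w + n \<in> band (\<epsilon> / 2)" using w by (simp add: k band_def)
    have eq: "z - (w + n) = v (w + n) - v z" by (simp add: shift[OF w n]) (simp add: n_def)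
    have "norm (z - (w + n)) \<le> norm (z - (w + n)) / 2"
      using lip[OF wn z] unfolding eq[symmetric] by (simp add: norm_minus_commute)
    then have "z - w = n" by simp
    then show "p = q" using n by (simp add: zw proj_eq_iff)
  qed
  moreover have "X ` strip (\<epsilon> / 2) \<subseteq> strip \<epsilon>"
  proof (rule image_subsetI)
    fix p assume p: "p \<in> strip (\<epsilon> / 2)"
    obtain z where z: "p = proj z" by (rule proj_cases)
    then show "X p \<in> strip \<epsilon>" using p X[of z] in_band[of z] by (simp add: proj_in_strip_iff)
  qed
  moreover have "f (X p) = X (rot \<alpha> p)" if p: "p \<in> strip (\<epsilon> / 2)" for p
  proof -
    obtain z where zp: "p = proj z" by (rule proj_cases)
    then have z: "z \<in> band (\<epsilon> / 2)" using p by (simp add: proj_in_strip_iff)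
    have "f (X p) = proj (z + v z + of_real \<alpha> + \<eta> (z + v z))"
      using X[OF z] f[OF in_band[OF z]] by (simp add: zp)
    also have "z + v z + of_real \<alpha> + \<eta> (z + v z) = z + of_real \<alpha> + v (z + of_real \<alpha>)"
      using conj[OF z] by (simp add: conj_error_def algebra_simps)
    also have "proj \<dots> = X (rot \<alpha> p)" using X[of "z + of_real \<alpha>"] z by (simp add: zp rot_proj)
    finally show ?thesis .
  qed
  ultimately show ?thesis unfolding conformally_conjugate_to_rot_def by blast
qed

lemma BT_diophantine:
  assumes "\<alpha> \<in> BT K"
  shows "diophantine (1 / (2 * (real K + 2))) \<alpha>"
proof -
  have "bounded_cf K \<alpha>" using assms by (auto simp: BT_def bounded_cf_def)
  then show ?thesis using small_divisor[of K \<alpha>] by (simp add: diophantine_def fmode_def)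
qed

theorem theorem1p1:
  fixes \<epsilon> :: real and K :: nat
  assumes "\<epsilon> > 0"
  shows "\<exists>\<kappa>>0. \<forall>f \<alpha>.
           f \<in> D_space \<epsilon> \<and> circle_diffeo f \<and> \<alpha> = rotation_number f \<and> \<alpha> \<in> BT K \<and>
           sup_dist \<epsilon> f (rot \<alpha>) < \<kappa> \<longrightarrow>
           conformally_conjugate_to_rot \<epsilon> f \<alpha>"
proof -
  obtain \<kappa>0 where \<kappa>0: "\<kappa>0 > 0" and newton: "\<forall>\<alpha> \<eta>. diophantine (1 / (2 * (real K + 2))) \<alpha>
      \<and> periodic_hol \<epsilon> \<eta> \<and> real_symmetric \<epsilon> \<eta> \<and> (\<forall>z\<in>band \<epsilon>. norm (\<eta> z) \<le> \<kappa>0) \<and> no_drift \<alpha> \<eta> \<longrightarrow>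
      (\<exists>v. periodic_hol (\<epsilon> / 2) v \<and> (\<forall>z\<in>band (\<epsilon> / 2). norm (v z) \<le> \<epsilon> / 8)
        \<and> (\<forall>x\<in>band (\<epsilon> / 2). \<forall>y\<in>band (\<epsilon> / 2). norm (v x - v y) \<le> norm (x - y) / 2)
        \<and> (\<forall>z\<in>band (\<epsilon> / 2). conj_error \<alpha> \<eta> v z = 0))"
    using newton_conjugacy[OF assms, of "1 / (2 * (real K + 2))"] by blast
  define \<kappa> where "\<kappa> = min \<kappa>0 (min (1 / 4) (\<epsilon> / 2))"
  have \<kappa>: "\<kappa> > 0" "\<kappa> \<le> \<kappa>0" "\<kappa> \<le> 1 / 4" "\<kappa> \<le> \<epsilon> / 2" using \<kappa>0 assms by (auto simp: \<kappa>_def)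
  have "conformally_conjugate_to_rot \<epsilon> f \<alpha>"
    if f: "f \<in> D_space \<epsilon>" "circle_diffeo f" "\<alpha> = rotation_number f" "\<alpha> \<in> BT K" "sup_dist \<epsilon> f (rot \<alpha>) < \<kappa>"
    for f \<alpha>
  proof -
    have hol: "cyl_holomorphic_on f (strip \<epsilon>)" using f(1) by (simp add: D_space_def)
    have circ: "f ` circle \<subseteq> circle" using f(2) by (simp add: circle_diffeo_def bij_betw_def)
    obtain \<eta> where \<eta>: "periodic_hol \<epsilon> \<eta>" "real_symmetric \<epsilon> \<eta>"
      "\<And>z. z \<in> band \<epsilon> \<Longrightarrow> norm (\<eta> z) < \<kappa>"
      "\<And>z. z \<in> band \<epsilon> \<Longrightarrow> f (proj z) = proj (z + of_real \<alpha> + \<eta> z)"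
      using lift_near_rotation[OF hol circ assms \<kappa>(3) dist_less_of_sup_dist[OF f(1,5)]] by blast
    have nd: "no_drift \<alpha> \<eta>" by (rule no_drift_near_rotation[OF assms \<eta>(1-3) \<kappa>(3,4) \<eta>(4) f(3)])
    have "\<forall>z\<in>band \<epsilon>. norm (\<eta> z) \<le> \<kappa>0" using \<eta>(3) \<kappa>(2) by force
    then obtain v where "periodic_hol (\<epsilon> / 2) v" "\<forall>z\<in>band (\<epsilon> / 2). norm (v z) \<le> \<epsilon> / 8"
      "\<forall>x\<in>band (\<epsilon> / 2). \<forall>y\<in>band (\<epsilon> / 2). norm (v x - v y) \<le> norm (x - y) / 2"
      "\<forall>z\<in>band (\<epsilon> / 2). conj_error \<alpha> \<eta> v z = 0"
      using newton BT_diophantine[OF f(4)] \<eta>(1,2) nd by blast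
    then show ?thesis by (intro conjugacy_descends[OF assms, of v \<alpha> \<eta> f] \<eta>(4)) auto
  qed
  then show ?thesis using \<kappa>(1) by blast
qed

end
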